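(* The explosion point of $\phi$ equals $r^*$, i.e. $\sup\{r\in\mathbb R:\phi(r)<\infty\}=r^*$, and $$\phi(r)=F^{-1}\big(\log r^*-\log r\big)\qquad\text{for all } 0<r<r^*.$$
   Context: Let $(\mathbf Z_n)_{n\ge 0}$ be the branching random walk on $\mathbb R_+^2$ started from a single particle at the origin, in which every particle of generation $n$ located at $y\in\mathbb R_+^2$ gives birth, independently of all other particles, to children located at $y+z$, where $z$ ranges over the atoms of an independent copy of a Poisson point process on $(0,\infty)^2$ whose intensity is Lebesgue measure $\mathrm dt\,\mathrm dx$; $\mathbf Z_n$ denotes the point measure of positions of generation $n$ (so $\mathbf Z_0=\delta_{(0,0)}$). Set $W_n=\int_{\mathbb R_+^2} e^{-t-x}\,\mathbf Z_n(\mathrm dt,\mathrm dx)$; $(W_n)_{n\ge0}$ is a nonnegative martingale of mean $1$ converging almost surely and in $L^1$ to a limit $W$ with $\mathbb E W=1$. Let $\phi(s)=\mathbb E(e^{sW})\in(0,\infty]$ for $s\in\mathbb R$. Define $$r^*=\exp\Big(\int_0^\infty\Big(\big(2(e^u-u-1)\big)^{-1/2}-u^{-1}\mathbf 1_{\{u<1\}}\Big)\mathrm du\Big)\in(0,\infty),$$ and $F:(1,\infty)\to(0,\infty)$, $F(y)=\int_{\log y}^\infty \frac{\mathrm du}{\sqrt{2(e^u-u-1)}}$, which is a strictly decreasing bijection with inverse $F^{-1}$. *)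

theory Defs
  imports "HOL-Probability.Probability"
begin

definition quadrant :: "(real \<times> real) set" where
  "quadrant = {0<..} \<times> {0<..}"

text \<open>A point process on the plane is given by an enumeration of its atoms
  (with multiplicity): \<open>\<xi> \<omega> k\<close> is the k-th atom.  The number of atoms in A.\<close>
definition pp_count :: "('a \<Rightarrow> nat \<Rightarrow> real \<times> real) \<Rightarrow> (real \<times> real) set \<Rightarrow> 'a \<Rightarrow> nat" where
  "pp_count \<xi> A \<omega> = card {k. \<xi> \<omega> k \<in> A}"

definition poisson_pp_lebesgue :: "'a measure \<Rightarrow> ('a \<Rightarrow> nat \<Rightarrow> real \<times> real) \<Rightarrow> bool" where
  "poisson_pp_lebesgue M \<xi> \<longleftrightarrow>
     \<xi> \<in> M \<rightarrow>\<^sub>M (\<Pi>\<^sub>M k\<in>UNIV. (borel :: (real \<times> real) measure)) \<and>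
     (AE \<omega> in M. \<forall>k. \<xi> \<omega> k \<in> quadrant) \<and>
     (\<forall>A. A \<in> sets lborel \<and> A \<subseteq> quadrant \<and> emeasure lborel A < \<infinity> \<longrightarrow>
        (AE \<omega> in M. finite {k. \<xi> \<omega> k \<in> A}) \<and>
        (\<forall>j::nat. measure M {\<omega> \<in> space M. pp_count \<xi> A \<omega> = j}
                   = measure lborel A ^ j / fact j * exp (- measure lborel A))) \<and>
     (\<forall>(A :: nat \<Rightarrow> (real \<times> real) set) I. finite I \<and> disjoint_family_on A I \<and>
        (\<forall>i\<in>I. A i \<in> sets lborel \<and> A i \<subseteq> quadrant \<and> emeasure lborel (A i) < \<infinity>) \<longrightarrow>
        prob_space.indep_vars M (\<lambda>_. count_space UNIV) (\<lambda>i. pp_count \<xi> (A i)) I)"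

text \<open>Branching random walk: particles are Ulam--Harris labels \<open>u :: nat list\<close>;
  \<open>\<xi> u\<close> is the (independent) offspring point process of particle u, and the
  k-th child of u is \<open>u @ [k]\<close>, displaced by \<open>\<xi> u \<omega> k\<close>.  Generation n consists
  of the labels of length n.\<close>
definition brw_pos :: "(nat list \<Rightarrow> 'a \<Rightarrow> nat \<Rightarrow> real \<times> real) \<Rightarrow> 'a \<Rightarrow> nat list \<Rightarrow> real \<times> real" where
  "brw_pos \<xi> \<omega> u = (\<Sum>i<length u. \<xi> (take i u) \<omega> (u ! i))"

text \<open>The additive martingale \<open>W_n = \<integral> e^{-t-x} Z_n(dt,dx)\<close>.\<close>
definition brw_W_n :: "(nat list \<Rightarrow> 'a \<Rightarrow> nat \<Rightarrow> real \<times> real) \<Rightarrow> nat \<Rightarrow> 'a \<Rightarrow> ennreal" where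
  "brw_W_n \<xi> n \<omega> =
     (\<integral>\<^sup>+ u. (if length u = n
               then ennreal (exp (- (fst (brw_pos \<xi> \<omega> u) + snd (brw_pos \<xi> \<omega> u)))) else 0)
        \<partial>count_space UNIV)"

text \<open>The a.s. limit W (defined pointwise as liminf; equals the limit a.s.).\<close>
definition brw_W :: "(nat list \<Rightarrow> 'a \<Rightarrow> nat \<Rightarrow> real \<times> real) \<Rightarrow> 'a \<Rightarrow> ennreal" where
  "brw_W \<xi> \<omega> = liminf (\<lambda>n. brw_W_n \<xi> n \<omega>)"

definition brw_phi :: "'a measure \<Rightarrow> (nat list \<Rightarrow> 'a \<Rightarrow> nat \<Rightarrow> real \<times> real) \<Rightarrow> real \<Rightarrow> ennreal" where
  "brw_phi M \<xi> s = (\<integral>\<^sup>+ \<omega>. ennreal (exp (s * enn2real (brw_W \<xi> \<omega>))) \<partial>M)"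

definition r_star :: real where
  "r_star = exp (LBINT u=0..\<infinity>.
      1 / sqrt (2 * (exp u - u - 1)) - (if u < 1 then 1 / u else 0))"

definition F_fun :: "real \<Rightarrow> real" where
  "F_fun y = (LBINT u=ln y..\<infinity>. 1 / sqrt (2 * (exp u - u - 1)))"

definition F_inv :: "real \<Rightarrow> real" where
  "F_inv = the_inv_into {1<..} F_fun"

end

theory Submission
  imports Defs
begin

text \<open>By the branching property and the exponential formula for Poisson processes,
  \<open>E exp (s W\<^sub>n) = exp (c\<^sub>n s)\<close> where \<open>c\<^sub>0 s = s\<close> and
  \<open>c\<^sub>n\<^sub>+\<^sub>1 s = \<integral>\<^sub>0\<^sup>\<infinity> z (exp (c\<^sub>n (s exp (-z))) - 1) dz\<close>.
  In the variable \<open>a = ln s\<close> a fixed point \<open>g a = c (exp a)\<close> solves \<open>g'' = exp g - 1\<close>;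
  the solution with \<open>g a \<sim> exp a\<close> at \<open>-\<infinity>\<close> has zero energy, \<open>g' = sqrt (2 (exp g - g - 1))\<close>,
  so that \<open>F (exp (g a)) = ln r\<^sup>* - a\<close>. It is a supersolution of the iteration, and a weighted
  contraction estimate shows that \<open>c\<^sub>n\<close> converges to it on \<open>(0, r\<^sup>*)\<close>. The increments of
  \<open>W\<^sub>n\<close> have second moment \<open>4\<^sup>-\<^sup>n\<^sup>-\<^sup>1\<close>, hence \<open>W\<^sub>n \<rightarrow> W\<close> almost surely, and since
  \<open>exp (s W\<^sub>n)\<close> is bounded in expectation for all \<open>s < r\<^sup>*\<close>, it is uniformly integrable for
  each such \<open>s\<close>. Thus \<open>\<phi> s = exp (g (ln s))\<close>, which tends to \<open>\<infinity>\<close> at \<open>r\<^sup>*\<close>.\<close>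

section \<open>Extended exponential\<close>

text \<open>The kernel \<open>z dz\<close> is the image of Lebesgue measure on the quadrant under
  \<open>(t, x) \<mapsto> t + x\<close>. It is also the Green kernel of the second derivative, which
  turns the fixed point equation into an ODE. The ODE is autonomous, so its increasing zero-energy
  solutions are translates of each other; the \<open>1 / u\<close> subtracted in
  \<open>r_star\<close> selects the translate that matches mean one.

  Lying below a fixed point does not identify the limit of the iteration, and there is no
  contraction on functions of order \<open>r\<close>: the linear part multiplies
  \<open>r ^ q\<close> by \<open>1 / q\<^sup>2\<close>, so \<open>q = 1\<close> is neutral. But the
  gap between the start \<open>r\<close> and the fixed point is of order \<open>r\<^sup>2\<close>,
  where the factor is \<open>1 / 4\<close>, and the derivative \<open>exp g\<close> of the
  nonlinearity is at most 2 near 0; a high power of \<open>r\<close> pays for the large derivative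
  near \<open>r_star\<close>.

  The Poisson process is known only through its counts, so the first two moments of the sum of
  weights are extracted from the exponential formula. Expectations live in
  \<open>[0, \<infinity>]\<close>, which postpones integrability questions; differences are
  therefore written as sums on the opposite side.\<close>

definition ennexp :: "ennreal \<Rightarrow> ennreal" where
  "ennexp x = (if x = \<top> then \<top> else ennreal (exp (enn2real x)))"

text \<open>Kept apart from \<open>ennexp\<close> because the exponential formula takes factors
  \<open>1 + h\<close>, and recovering \<open>h\<close> by subtraction would be awkward in
  \<open>ennreal\<close>.\<close>

definition ennexpm1 :: "ennreal \<Rightarrow> ennreal" where
  "ennexpm1 x = (if x = \<top> then \<top> else ennreal (exp (enn2real x) - 1))"

lemma ennexp_top [simp]: "ennexp \<top> = \<top>"
  by (simp add: ennexp_def)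

lemma ennexp_ennreal: "0 \<le> r \<Longrightarrow> ennexp (ennreal r) = ennreal (exp r)"
  by (simp add: ennexp_def)

lemma ennexpm1_ennreal: "0 \<le> r \<Longrightarrow> ennexpm1 (ennreal r) = ennreal (exp r - 1)"
  by (simp add: ennexpm1_def)

lemma ennexp_0 [simp]: "ennexp 0 = 1"
  by (simp add: ennexp_def)

lemma one_plus_ennexpm1: "1 + ennexpm1 x = ennexp x"
  by (cases x) (auto simp: ennexp_def ennexpm1_def simp flip: ennreal_1 ennreal_plus)

lemma ennexp_mono: "x \<le> y \<Longrightarrow> ennexp x \<le> ennexp y"
  by (cases x; cases y) (auto simp: ennexp_def top_unique)

lemma ennexpm1_mono: "x \<le> y \<Longrightarrow> ennexpm1 x \<le> ennexpm1 y"
  by (cases x; cases y) (auto simp: ennexpm1_def top_unique intro!: ennreal_leI)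

lemma ennexp_ge_plus: "1 + x \<le> ennexp x"
  by (cases x) (auto simp: ennexp_def exp_ge_add_one_self simp flip: ennreal_1 ennreal_plus intro!: ennreal_leI)

lemma ennexp_add: "ennexp (x + y) = ennexp x * ennexp y"
  by (cases x; cases y)
     (auto simp: ennexp_def ennreal_mult_top ennreal_top_mult exp_add ennreal_mult simp flip: ennreal_plus)

lemma ennexp_sum: "finite A \<Longrightarrow> ennexp (sum f A) = (\<Prod>k\<in>A. ennexp (f k))"
  by (induction rule: finite_induct) (auto simp: ennexp_add)

lemma measurable_ennexp [measurable]: "ennexp \<in> borel_measurable borel"
  unfolding ennexp_def by measurable

lemma measurable_ennexpm1 [measurable]: "ennexpm1 \<in> borel_measurable borel"
  unfolding ennexpm1_def by measurable

text \<open>Continuity from below. A finite supremum reduces to continuity of the real exponential;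
  an infinite one follows from \<open>1 + x \<le> ennexp x\<close>.\<close>

lemma ennexp_SUP:
  fixes f :: "nat \<Rightarrow> ennreal"
  assumes "incseq f"
  shows "ennexp (SUP i. f i) = (SUP i. ennexp (f i))"
proof (cases "(SUP i. f i) = \<top>")
  case True
  have "(SUP i. f i) \<le> (SUP i. ennexp (f i))"
    using ennexp_ge_plus by (intro SUP_mono) (meson UNIV_I add_increasing order_trans order_refl zero_le)
  then show ?thesis unfolding True ennexp_top by (simp only: top_unique)
next
  case False
  define S where "S = (SUP i. f i)"
  have le: "f i \<le> S" for i
    unfolding S_def by (rule SUP_upper) simp
  have S: "S < \<top>"
    using False by (simp only: S_def less_top)
  have lt: "f i < \<top>" for i
    using le S by (rule le_less_trans)
  have "f \<longlonglongrightarrow> S"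
    unfolding S_def using assms by (rule LIMSEQ_SUP)
  then have "(\<lambda>i. enn2real (f i)) \<longlonglongrightarrow> enn2real S"
    using S lt by (intro tendsto_enn2real) auto
  then have "(\<lambda>i. ennreal (exp (enn2real (f i)))) \<longlonglongrightarrow> ennreal (exp (enn2real S))"
    by (intro tendsto_ennrealI tendsto_exp)
  moreover have "ennexp x = ennreal (exp (enn2real x))" if "x < \<top>" for x
    using that by (simp add: ennexp_def)
  ultimately have "(\<lambda>i. ennexp (f i)) \<longlonglongrightarrow> ennexp S"
    using S lt by simp
  moreover have "incseq (\<lambda>i. ennexp (f i))"
    using assms by (auto simp: incseq_def intro!: ennexp_mono)
  ultimately show ?thesis
    unfolding S_def using LIMSEQ_SUP LIMSEQ_unique by blast
qed

text \<open>The exponential of a sum over infinitely many children becomes an increasing limit of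
  finite products, to which independence and monotone convergence apply.\<close>

lemma ennexp_suminf: "ennexp (\<Sum>k. f k) = (SUP K. \<Prod>k<K. ennexp (f k))"
proof -
  have "(\<Sum>k. f k) = (SUP K. \<Sum>k<K. f k)"
    by (rule suminf_eq_SUP)
  moreover have "incseq (\<lambda>K. \<Sum>k<K. f k)"
    by (auto simp: incseq_def intro!: sum_mono2)
  ultimately show ?thesis by (simp add: ennexp_SUP ennexp_sum)
qed

section \<open>The solution of the limiting equation\<close>

text \<open>Reciprocal of the zero-energy speed: the increase of \<open>a\<close> per unit increase
  of the height \<open>g a\<close>. It behaves like \<open>1 / u\<close> at 0, which calls for
  regularisation, and is integrable at infinity, which is why \<open>g\<close> explodes at a finite
  \<open>a\<close>.\<close>

definition explosion_rate :: "real \<Rightarrow> real" where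
  "explosion_rate u = 1 / sqrt (2 * (exp u - u - 1))"

lemma exp_remainder_ge:
  fixes u :: real
  assumes "0 \<le> u"
  shows "u\<^sup>2 \<le> 2 * (exp u - u - 1)"
  using exp_lower_Taylor_quadratic[OF assms] by (simp add: field_simps)

lemma exp_remainder_pos:
  fixes u :: real
  assumes "0 < u" shows "0 < exp u - u - 1"
proof -
  have "0 < u\<^sup>2" using assms by simp
  also have "\<dots> \<le> 2 * (exp u - u - 1)" using exp_remainder_ge[of u] assms by simp
  finally show ?thesis by (rule zero_less_mult_pos) simp
qed

text \<open>Divided by \<open>2 * exp u\<close>, this is
  \<open>1 \<le> (1 + u) * exp (- u) + u\<^sup>2 / 2\<close>; equality holds at 0 and the right side
  has derivative \<open>u * (1 - exp (- u))\<close>.\<close>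

lemma exp_remainder_le:
  fixes u :: real
  assumes "0 \<le> u"
  shows "2 * (exp u - u - 1) \<le> u\<^sup>2 * exp u"
proof -
  let ?f = "\<lambda>u::real. (1 + u) * exp (- u) + u\<^sup>2 / 2"
  have "?f 0 \<le> ?f u"
  proof (rule DERIV_nonneg_imp_nondecreasing[OF assms])
    fix x :: real assume x: "0 \<le> x"
    have "(?f has_real_derivative x * (1 - exp (- x))) (at x)"
      by (auto intro!: derivative_eq_intros simp: algebra_simps)
    moreover have "0 \<le> x * (1 - exp (- x))" using x by simp
    ultimately show "\<exists>y. (?f has_real_derivative y) (at x) \<and> 0 \<le> y" by blast
  qed
  then have "1 \<le> (1 + u) * exp (- u) + u\<^sup>2 / 2" by simp
  then have "1 * (2 * exp u) \<le> ((1 + u) * exp (- u) + u\<^sup>2 / 2) * (2 * exp u)"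
    by (intro mult_right_mono) auto
  also have "\<dots> = 2 * (1 + u) + u\<^sup>2 * exp u"
    by (simp add: algebra_simps exp_minus field_simps)
  finally show ?thesis by (simp add: algebra_simps)
qed

lemma sqrt_exp_remainder_le:
  assumes "0 \<le> u" shows "sqrt (2 * (exp u - u - 1)) \<le> u * exp (u / 2)"
proof -
  have "u\<^sup>2 * exp u = (u * exp (u / 2))\<^sup>2"
    by (simp add: power_mult_distrib flip: exp_double)
  then have "2 * (exp u - u - 1) \<le> (u * exp (u / 2))\<^sup>2"
    using exp_remainder_le[OF assms] by linarith
  then show ?thesis using assms by (intro real_le_lsqrt) auto
qed

lemma explosion_rate_pos: "0 < u \<Longrightarrow> 0 < explosion_rate u"
  using exp_remainder_pos[of u] by (simp add: explosion_rate_def algebra_simps)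

lemma explosion_rate_le:
  assumes "0 < u" shows "explosion_rate u \<le> 1 / u"
proof -
  have "u \<le> sqrt (2 * (exp u - u - 1))"
    using exp_remainder_ge[of u] assms by (intro real_le_rsqrt) auto
  moreover from this have "0 < sqrt (2 * (exp u - u - 1))" using assms by linarith
  ultimately show ?thesis
    unfolding explosion_rate_def using assms by (intro divide_left_mono mult_pos_pos) auto
qed

text \<open>Together with the upper bound \<open>1 / u\<close>, this leaves a bounded difference at
  0, so the regularised integrand of \<open>r_star\<close> is integrable there.\<close>

lemma explosion_rate_ge:
  assumes "0 < u" shows "1 / u - 1 / 2 \<le> explosion_rate u"
proof -
  have "1 / u - 1 / 2 = (1 - u / 2) / u" using assms by (simp add: field_simps)
  also have "\<dots> \<le> exp (- (u / 2)) / u"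
    using exp_ge_add_one_self[of "- (u / 2)"] assms by (intro divide_right_mono) auto
  also have "\<dots> = 1 / (u * exp (u / 2))" by (simp add: exp_minus field_simps)
  also have "\<dots> \<le> explosion_rate u"
    unfolding explosion_rate_def using sqrt_exp_remainder_le[of u] exp_remainder_pos[OF assms] assms
    by (intro divide_left_mono mult_pos_pos) auto
  finally show ?thesis .
qed

text \<open>Squaring the quadratic Taylor bound of \<open>exp (u / 2)\<close> supplies a quartic
  term below \<open>exp u\<close>. The true decay is exponential, but \<open>1 / u\<^sup>2\<close>
  has an explicit primitive.\<close>

lemma explosion_rate_le_inverse_square:
  assumes "0 < u" shows "explosion_rate u \<le> 6 / u\<^sup>2"
proof -
  have "1 + (u / 2) + (u / 2)\<^sup>2 / 2 \<le> exp (u / 2)"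
    using assms by (intro exp_lower_Taylor_quadratic) auto
  then have "(1 + (u / 2) + (u / 2)\<^sup>2 / 2)\<^sup>2 \<le> (exp (u / 2))\<^sup>2"
    using assms by (intro power_mono) auto
  then have "(1 + (u / 2) + (u / 2)\<^sup>2 / 2)\<^sup>2 \<le> exp u"
    by (simp flip: exp_double)
  also have "(1 + (u / 2) + (u / 2)\<^sup>2 / 2)\<^sup>2 = 1 + u + u\<^sup>2 / 2 + u^3 / 8 + u^4 / 64"
    by (simp add: power2_eq_square power3_eq_cube power4_eq_xxxx field_simps)
  finally have *: "1 + u + u\<^sup>2 / 2 + u^3 / 8 + u^4 / 64 \<le> exp u" .
  \<comment> \<open>Powers of \<open>u\<close> are replaced by variables to make the claim linear.
    The available coefficient is \<open>2 / 64\<close>; it is lowered to \<open>1 / 36\<close> to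
    obtain the perfect square \<open>(u\<^sup>2 / 6)\<^sup>2\<close>.\<close>
  have "c / 36 \<le> 2 * e - 2 * u - 2"
    if "1 + u + a / 2 + b / 8 + c / 64 \<le> e" "0 \<le> a" "0 \<le> b" "0 \<le> c" for a b c e :: real
    using that by linarith
  from this[OF *] have "u^4 / 36 \<le> 2 * (exp u - u - 1)"
    using assms by (simp add: right_diff_distrib)
  then have "(u\<^sup>2 / 6)\<^sup>2 \<le> 2 * (exp u - u - 1)" by (simp add: power_divide)
  then have "u\<^sup>2 / 6 \<le> sqrt (2 * (exp u - u - 1))" by (intro real_le_rsqrt) auto
  then have "1 / sqrt (2 * (exp u - u - 1)) \<le> 1 / (u\<^sup>2 / 6)"
    using assms exp_remainder_pos[OF assms]
    by (intro divide_left_mono mult_pos_pos) (simp_all add: algebra_simps)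
  then show ?thesis by (simp add: explosion_rate_def)
qed

lemma continuous_on_explosion_rate: "continuous_on {0<..} explosion_rate"
  unfolding explosion_rate_def using exp_remainder_pos
  by (intro continuous_intros) (auto simp: less_imp_neq[symmetric] dest: exp_remainder_pos)

lemma measurable_explosion_rate [measurable]: "explosion_rate \<in> borel_measurable borel"
  unfolding explosion_rate_def by measurable

section \<open>Integrability of the rate and of its regularisation\<close>

definition regularised_rate :: "real \<Rightarrow> real" where
  "regularised_rate u = explosion_rate u - (if u < 1 then 1 / u else 0)"

lemma measurable_regularised_rate [measurable]: "regularised_rate \<in> borel_measurable borel"
  unfolding regularised_rate_def by measurable

lemma inverse_square_Ioi:
  assumes "0 < (u::real)"
  shows "set_integrable lborel {u<..} (\<lambda>x. 1 / x\<^sup>2)" "(LBINT x:{u<..}. 1 / x\<^sup>2) = 1 / u"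
proof -
  have 1: "((\<lambda>x. - (1 / x)) has_real_derivative 1 / x\<^sup>2) (at x)" if "0 < x" for x :: real
    using that by (auto intro!: derivative_eq_intros simp: power2_eq_square)
  have A: "(((\<lambda>x. - (1 / x)) \<circ> real_of_ereal) \<longlongrightarrow> - (1 / u)) (at_right (ereal u))"
    unfolding ereal_tendsto_simps using assms by (auto intro!: tendsto_intros)
  have B: "(((\<lambda>x. - (1 / x)) \<circ> real_of_ereal) \<longlongrightarrow> 0) (at_left \<infinity>)"
    unfolding ereal_tendsto_simps by real_asymp
  have c: "isCont (\<lambda>x. 1 / x\<^sup>2) x" if "0 < x" for x :: real
    using that by (auto intro!: continuous_intros)
  have "set_integrable lborel (einterval u \<infinity>) (\<lambda>x. 1 / x\<^sup>2)"
    by (rule interval_integral_FTC_nonneg(1)[where F = "\<lambda>x. - (1 / x)", OF _ 1 c _ A B]) (use assms in auto)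
  then show "set_integrable lborel {u<..} (\<lambda>x. 1 / x\<^sup>2)" by simp
  have "(LBINT x=u..\<infinity>. 1 / x\<^sup>2) = 0 - - (1 / u)"
    by (rule interval_integral_FTC_nonneg(2)[where F = "\<lambda>x. - (1 / x)", OF _ 1 c _ A B]) (use assms in auto)
  then show "(LBINT x:{u<..}. 1 / x\<^sup>2) = 1 / u"
    by (simp add: interval_integral_to_infinity_eq)
qed

lemma explosion_rate_integrable:
  assumes "0 < u" shows "set_integrable lborel {u<..} explosion_rate"
proof (rule set_integrable_bound)
  show "set_integrable lborel {u<..} (\<lambda>x. 6 * (1 / x\<^sup>2))"
    using inverse_square_Ioi(1)[OF assms] by (rule set_integrable_mult_right)
  show "set_borel_measurable lborel {u<..} explosion_rate"
    unfolding set_borel_measurable_def by measurable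
  show "AE x in lborel. x \<in> {u<..} \<longrightarrow> norm (explosion_rate x) \<le> norm (6 * (1 / x\<^sup>2))"
  proof (intro AE_I2 impI)
    fix x assume "x \<in> {u<..}"
    then show "norm (explosion_rate x) \<le> norm (6 * (1 / x\<^sup>2))"
      using explosion_rate_le_inverse_square[of x] explosion_rate_pos[of x] assms by auto
  qed
qed

lemma regularised_rate_bounds:
  assumes "0 < u" "u < 1"
  shows "regularised_rate u \<le> 0" "- (1 / 2) \<le> regularised_rate u"
  using explosion_rate_le[of u] explosion_rate_ge[of u] assms by (auto simp: regularised_rate_def)

lemma regularised_rate_integrable_Ioc:
  assumes "0 < u" "u < 1" shows "set_integrable lborel {0<..u} regularised_rate"
proof (rule set_integrable_bound)
  show "set_integrable lborel {0<..u} (\<lambda>x. 1::real)"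
    unfolding set_integrable_def using assms by simp
  show "set_borel_measurable lborel {0<..u} regularised_rate"
    unfolding set_borel_measurable_def by measurable
  show "AE x in lborel. x \<in> {0<..u} \<longrightarrow> norm (regularised_rate x) \<le> norm (1::real)"
  proof (intro AE_I2 impI)
    fix x assume "x \<in> {0<..u}"
    then show "norm (regularised_rate x) \<le> norm (1::real)"
      using regularised_rate_bounds[of x] assms by auto
  qed
qed

text \<open>The cut-off term \<open>1 / x\<close> integrates to \<open>- ln u\<close> over
  \<open>(u, 1)\<close>; this is the source of the logarithm in the normalisation of
  \<open>log_scale\<close>.\<close>

lemma regularised_rate_Ioi:
  assumes "0 < u" "u < 1"
  shows "set_integrable lborel {u<..} regularised_rate"
    "(LBINT v:{u<..}. regularised_rate v) = (LBINT v:{u<..}. explosion_rate v) + ln u"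
proof -
  have 1: "((\<lambda>x. ln x) has_real_derivative 1 / x) (at x)" if "0 < x" for x :: real
    using that by (auto intro!: derivative_eq_intros simp: power2_eq_square)
  have A: "((ln \<circ> real_of_ereal) \<longlongrightarrow> ln u) (at_right (ereal u))"
    unfolding ereal_tendsto_simps using assms by (auto intro!: tendsto_intros)
  have B: "((ln \<circ> real_of_ereal) \<longlongrightarrow> ln 1) (at_left (ereal 1))"
    unfolding ereal_tendsto_simps by (rule tendsto_ln) auto
  have c: "isCont (\<lambda>x. 1 / x) x" if "0 < x" for x :: real
    using that by (auto intro!: continuous_intros)
  have i: "set_integrable lborel (einterval u (ereal 1)) (\<lambda>x. 1 / x)"
    by (rule interval_integral_FTC_nonneg(1)[where F = ln, OF _ 1 c _ A B]) (use assms in auto)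
  have v: "(LBINT x=u..ereal 1. 1 / x) = ln 1 - ln u"
    by (rule interval_integral_FTC_nonneg(2)[where F = ln, OF _ 1 c _ A B]) (use assms in auto)
  have eq: "(\<lambda>x. indicator {u<..} x *\<^sub>R (if x < 1 then 1 / x else 0)) =
    (\<lambda>x. indicator (einterval u (ereal 1)) x *\<^sub>R (1 / x))" 
    by (auto simp: fun_eq_iff indicator_def)
  have i': "set_integrable lborel {u<..} (\<lambda>x. if x < 1 then 1 / x else 0)"
    using i unfolding set_integrable_def eq .
  have v': "(LBINT x:{u<..}. (if x < 1 then 1 / x else 0)) = - ln u"
    using v assms unfolding set_lebesgue_integral_def eq
    by (simp add: interval_lebesgue_integral_def set_lebesgue_integral_def)
  show "set_integrable lborel {u<..} regularised_rate"
    "(LBINT v:{u<..}. regularised_rate v) = (LBINT v:{u<..}. explosion_rate v) + ln u"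
    unfolding regularised_rate_def 
    using explosion_rate_integrable[OF assms(1)] i' v' by (simp_all add: set_integral_diff)
qed

section \<open>The logarithmic scale as a function of the height\<close>

definition explosion_time :: "real \<Rightarrow> real" where
  "explosion_time u = (LBINT v:{u<..}. explosion_rate v)"

lemma F_fun_eq: "F_fun y = explosion_time (ln y)"
  by (simp add: F_fun_def explosion_time_def explosion_rate_def interval_integral_to_infinity_eq)

lemma ln_r_star: "ln r_star = (LBINT u:{0<..}. regularised_rate u)"
  by (simp add: r_star_def regularised_rate_def[abs_def] explosion_rate_def[abs_def]
      interval_lebesgue_integral_0_infty(2))

lemma r_star_pos: "0 < r_star"
  by (simp add: r_star_def)

text \<open>The inverse function of the sought solution: the point \<open>a = ln r\<close> at which
  \<open>g\<close> has height \<open>u\<close>. It is the explosion point \<open>ln r_star\<close>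
  minus the time still needed to climb from \<open>u\<close> to infinity.\<close>

definition log_scale :: "real \<Rightarrow> real" where
  "log_scale u = ln r_star - explosion_time u"

text \<open>By the choice of \<open>r_star\<close>, \<open>log_scale u - ln u\<close> is the
  integral of \<open>regularised_rate\<close> over \<open>(0, u]\<close>, whose integrand lies
  between \<open>-1/2\<close> and 0. For the inverse function this means
  \<open>log_cumulant r \<sim> r\<close> at 0.\<close>

lemma log_scale_near_0:
  assumes "0 < u" "u < 1"
  shows "log_scale u \<le> ln u" "ln u - u / 2 \<le> log_scale u"
proof -
  have "{0<..} = {0<..u} \<union> {u<..}" using assms by auto
  then have "ln r_star = (LBINT v:{0<..u} \<union> {u<..}. regularised_rate v)"
    unfolding ln_r_star by simp
  also have "\<dots> = (LBINT v:{0<..u}. regularised_rate v) + (LBINT v:{u<..}. regularised_rate v)"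
    by (intro set_integral_Un regularised_rate_integrable_Ioc regularised_rate_Ioi(1) assms) auto
  finally have *: "log_scale u = ln u + (LBINT v:{0<..u}. regularised_rate v)"
    unfolding log_scale_def explosion_time_def regularised_rate_Ioi(2)[OF assms] by simp
  have i: "set_integrable lborel {0<..u} (\<lambda>x. c::real)" for c
    unfolding set_integrable_def using assms by simp
  have "(LBINT v:{0<..u}. regularised_rate v) \<le> (LBINT v:{0<..u}. 0)"
    by (intro set_integral_mono regularised_rate_integrable_Ioc i assms regularised_rate_bounds)
      (use assms in auto)
  then show "log_scale u \<le> ln u" by (simp add: *)
  have "(LBINT v:{0<..u}. - (1/2)) \<le> (LBINT v:{0<..u}. regularised_rate v)"
    by (intro set_integral_mono regularised_rate_integrable_Ioc i assms regularised_rate_bounds)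
      (use assms in auto)
  then show "ln u - u / 2 \<le> log_scale u"
    using assms by (simp add: * set_integral_const)
qed

lemma DERIV_log_scale:
  assumes "0 < u" shows "(log_scale has_real_derivative explosion_rate u) (at u)"
proof -
  \<comment> \<open>Any base point strictly between 0 and \<open>u\<close> would serve; 0 would not,
    as the rate is not integrable there.\<close>
  let ?c = "u / 2"
  have split: "log_scale x = log_scale ?c + (LBINT y=?c..x. explosion_rate y)" if "?c < x" for x
  proof -
    have "interval_lebesgue_integrable lborel (ereal ?c) \<infinity> explosion_rate"
      using explosion_rate_integrable[of ?c] assms by (simp add: interval_integrable_to_infinity_eq)
    moreover have "min (ereal ?c) (min (ereal x) \<infinity>) = ereal ?c" "max (ereal ?c) (max (ereal x) \<infinity>) = \<infinity>"
      using that by simp_all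
    ultimately have "(LBINT y=?c..x. explosion_rate y) + (LBINT y=x..\<infinity>. explosion_rate y) = (LBINT y=?c..\<infinity>. explosion_rate y)"
      by (metis interval_integral_sum)
    then show ?thesis by (simp add: log_scale_def explosion_time_def interval_integral_to_infinity_eq)
  qed
  have "((\<lambda>x. LBINT y=?c..x. explosion_rate y) has_vector_derivative explosion_rate u) (at u within {?c..u+1})"
    using assms
    by (intro interval_integral_FTC2 continuous_on_subset[OF continuous_on_explosion_rate]) auto
  then have "((\<lambda>x. LBINT y=?c..x. explosion_rate y) has_real_derivative explosion_rate u) (at u within {?c..u+1})"
    by (simp add: has_real_derivative_iff_has_vector_derivative)
  moreover have "at u within {?c..u+1} = at u"
    using assms by (intro at_within_Icc_at) auto
  ultimately have "((\<lambda>x. LBINT y=?c..x. explosion_rate y) has_real_derivative explosion_rate u) (at u)"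
    by simp
  then have "((\<lambda>x. log_scale ?c + (LBINT y=?c..x. explosion_rate y)) has_real_derivative explosion_rate u) (at u)"
    by (auto intro!: derivative_eq_intros)
  moreover have "eventually (\<lambda>x. x \<in> {?c<..}) (nhds u)"
    using assms by (intro eventually_nhds_in_open) auto
  ultimately show ?thesis
    by (subst DERIV_cong_ev[OF refl _ refl]) (auto elim!: eventually_mono intro: split)
qed

text \<open>Since \<open>explosion_rate u \<le> 1 / u\<close>, the difference
  \<open>log_scale - ln\<close> does not increase, so the bound near 0 persists. It yields
  \<open>r \<le> log_cumulant r\<close>, the base case of the upper bound on the iteration.\<close>

lemma log_scale_le_ln:
  assumes "0 < u" shows "log_scale u \<le> ln u"
proof (cases "u < 1")
  case True then show ?thesis using log_scale_near_0 assms by simp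
next
  case False
  have "log_scale u - ln u \<le> log_scale (1/2) - ln (1/2)"
  proof (rule DERIV_nonpos_imp_nonincreasing[of "1/2" u])
    fix x :: real assume x: "1/2 \<le> x"
    have "((\<lambda>u. log_scale u - ln u) has_real_derivative explosion_rate x - 1 / x) (at x)"
      using x by (auto intro!: derivative_eq_intros DERIV_log_scale)
    then show "\<exists>y. ((\<lambda>u. log_scale u - ln u) has_real_derivative y) (at x) \<and> y \<le> 0"
      using explosion_rate_le[of x] x by (intro exI conjI) auto
  qed (use False in auto)
  then show ?thesis using log_scale_near_0(1)[of "1/2"] by simp
qed

lemma explosion_time_bounds:
  assumes "0 < u" shows "0 \<le> explosion_time u" "explosion_time u \<le> 6 / u"
proof -
  show "0 \<le> explosion_time u"
    unfolding explosion_time_def set_lebesgue_integral_def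
    using assms
    by (intro Bochner_Integration.integral_nonneg)
      (auto simp: indicator_def intro!: less_imp_le[OF explosion_rate_pos])
  have "explosion_time u \<le> (LBINT x:{u<..}. 6 * (1 / x\<^sup>2))"
    unfolding explosion_time_def using assms
    by (intro set_integral_mono explosion_rate_integrable set_integrable_mult_right
        inverse_square_Ioi(1)) (auto intro!: order_trans[OF explosion_rate_le_inverse_square])
  also have "\<dots> = 6 / u" unfolding set_integral_mult_right using inverse_square_Ioi(2)[OF assms] by simp
  finally show "explosion_time u \<le> 6 / u" .
qed

lemma log_scale_strict_mono:
  assumes "0 < u" "u < v" shows "log_scale u < log_scale v"
proof (rule DERIV_pos_imp_increasing[OF assms(2)])
  fix x assume "u \<le> x"
  then show "\<exists>y. (log_scale has_real_derivative y) (at x) \<and> 0 < y"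
    using assms by (intro exI[of _ "explosion_rate x"] conjI DERIV_log_scale explosion_rate_pos) auto
qed

lemma log_scale_less:
  assumes "0 < u" shows "log_scale u < ln r_star"
  using log_scale_strict_mono[OF assms, of "u + 1"] explosion_time_bounds[of "u + 1"] assms
  by (simp add: log_scale_def)

lemma log_scale_surj:
  assumes "a < ln r_star"
  shows "\<exists>u>0. log_scale u = a"
proof -
  \<comment> \<open>The two ends for the intermediate value theorem: at \<open>exp a\<close> the
    bound by \<open>ln\<close> gives a value at most \<open>a\<close>, and at \<open>v\<close> the
    tail bound \<open>6 / v\<close> of \<open>explosion_time\<close> forces a value at least
    \<open>a\<close>.\<close>
  define u v where "u = exp a" and "v = max u (6 / (ln r_star - a))"
  have u: "0 < u" "log_scale u \<le> a"
    using log_scale_le_ln[of u] by (auto simp: u_def)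
  have v: "0 < v" "u \<le> v" using u by (auto simp: v_def)
  have "6 / v \<le> 6 / (6 / (ln r_star - a))"
    using assms by (intro divide_left_mono) (auto simp: v_def intro!: mult_pos_pos divide_pos_pos, simp add: u_def less_max_iff_disj)
  then have "a \<le> log_scale v"
    using explosion_time_bounds[OF v(1)] assms by (simp add: log_scale_def)
  then have "\<exists>x\<ge>u. x \<le> v \<and> log_scale x = a"
    using u v by (intro IVT) (auto intro!: DERIV_isCont DERIV_log_scale)
  then obtain x where "u \<le> x" "log_scale x = a" by blast
  then show ?thesis using u by (intro exI[of _ x]) simp
qed


text \<open>The candidate for \<open>ln (\<phi> r)\<close>, namely \<open>g (ln r)\<close>. The
  description has a unique witness for \<open>0 < r < r_star\<close>, the only range in which it is
  evaluated.\<close>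

definition log_cumulant :: "real \<Rightarrow> real" where
  "log_cumulant r = (THE u. 0 < u \<and> log_scale u = ln r)"

lemma log_scale_inject:
  assumes "0 < u" "0 < v" "log_scale u = log_scale v" shows "u = v"
  using log_scale_strict_mono[of u v] log_scale_strict_mono[of v u] assms
  by (cases u v rule: linorder_cases) auto

lemma log_cumulant_eqI:
  assumes "0 < u" "log_scale u = ln r" shows "log_cumulant r = u"
  unfolding log_cumulant_def using assms by (intro the_equality) (auto intro: log_scale_inject)

lemma log_cumulant_spec:
  assumes "0 < r" "r < r_star"
  shows "0 < log_cumulant r" "log_scale (log_cumulant r) = ln r"
proof -
  have "ln r < ln r_star" using assms by simp
  then obtain u where "0 < u" "log_scale u = ln r" using log_scale_surj by blast
  then show "0 < log_cumulant r" "log_scale (log_cumulant r) = ln r"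
    by (simp_all add: log_cumulant_eqI)
qed

lemma F_inv_eq:
  assumes "0 < r" "r < r_star"
  shows "F_inv (ln r_star - ln r) = exp (log_cumulant r)"
  unfolding F_inv_def
proof (rule the_inv_into_f_eq)
  show "inj_on F_fun {1<..}"
  proof (rule inj_onI)
    fix x y assume *: "x \<in> {1<..}" "y \<in> {1<..}" "F_fun x = F_fun y"
    have "ln x = ln y"
      by (rule log_scale_inject) (use * in \<open>auto simp: log_scale_def F_fun_eq\<close>)
    moreover have "0 < x" "0 < y" using * by auto
    ultimately show "x = y" by simp
  qed
  show "F_fun (exp (log_cumulant r)) = ln r_star - ln r"
    using log_cumulant_spec(2)[OF assms] unfolding F_fun_eq ln_exp log_scale_def by linarith
  show "exp (log_cumulant r) \<in> {1<..}"
    using log_cumulant_spec[OF assms] by simp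
qed

lemma log_cumulant_strict_mono:
  assumes "0 < r" "r < r'" "r' < r_star"
  shows "log_cumulant r < log_cumulant r'"
proof (rule ccontr)
  assume *: "\<not> log_cumulant r < log_cumulant r'"
  have "log_scale (log_cumulant r') \<le> log_scale (log_cumulant r)"
    using * log_cumulant_spec[of r'] assms log_scale_strict_mono[of "log_cumulant r'" "log_cumulant r"]
    by (cases "log_cumulant r = log_cumulant r'") auto
  then show False
    using log_cumulant_spec(2)[of r] log_cumulant_spec(2)[of r'] assms by simp
qed

lemma log_cumulant_ge:
  assumes "0 < r" "r < r_star" shows "r \<le> log_cumulant r"
  using log_scale_le_ln[of "log_cumulant r"] log_cumulant_spec[OF assms] assms by simp

text \<open>Every positive height is attained strictly below \<open>r_star\<close>. A small height
  gives the threshold \<open>r1\<close> near 0; arbitrarily large heights give the blow-up at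
  \<open>r_star\<close>.\<close>

lemma log_cumulant_at_exp_log_scale:
  assumes "0 < u"
  shows "exp (log_scale u) < r_star" "log_cumulant (exp (log_scale u)) = u"
proof -
  have "exp (log_scale u) < exp (ln r_star)"
    using log_scale_less[OF assms] by (simp only: exp_less_cancel_iff)
  then show "exp (log_scale u) < r_star" using r_star_pos by simp
  show "log_cumulant (exp (log_scale u)) = u"
    using assms by (intro log_cumulant_eqI) auto
qed

text \<open>For \<open>u = log_cumulant r\<close> the bound \<open>ln u - u / 2 \<le> ln r\<close>
  reads \<open>u \<le> r * exp (u / 2)\<close>. Up to height \<open>1/2\<close> this gives
  \<open>u \<le> 2 * r\<close>, and inserting that into the exponent gives the second-order bound.
  The threshold \<open>r1\<close> is the point of height \<open>1/2\<close>.\<close>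

lemma log_cumulant_near_0:
  obtains r1 where "0 < r1" "r1 \<le> 1" "r1 < r_star"
    "\<And>r. 0 < r \<Longrightarrow> r \<le> r1 \<Longrightarrow> log_cumulant r \<le> 2 * r"
    "\<And>r. 0 < r \<Longrightarrow> r \<le> r1 \<Longrightarrow> log_cumulant r \<le> r + 2 * r\<^sup>2"
    "\<And>r. 0 < r \<Longrightarrow> r \<le> r1 \<Longrightarrow> exp (log_cumulant r) \<le> 2"
proof -
  define r1 where "r1 = exp (log_scale (1/2))"
  have r1: "0 < r1" "r1 < r_star" "log_cumulant r1 = 1/2"
    using log_cumulant_at_exp_log_scale[of "1/2"] by (auto simp: r1_def)
  have "r1 \<le> 1" using log_cumulant_ge[OF r1(1,2)] r1(3) by simp
  have e: "exp x \<le> 1 + 2 * x" if "0 \<le> x" "x \<le> 1" for x :: real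
  proof -
    have "x\<^sup>2 \<le> x" using that by (simp add: power2_eq_square mult_left_le)
    then show ?thesis using exp_bound[OF that] by linarith
  qed
  have main: "log_cumulant r \<le> 1/2 \<and> log_cumulant r \<le> 2 * r \<and> log_cumulant r \<le> r + 2 * r\<^sup>2"
    if r: "0 < r" "r \<le> r1" for r
  proof -
    let ?u = "log_cumulant r"
    have rs: "r < r_star" using r r1 by simp
    have u: "0 < ?u" "?u \<le> 1/2" "log_scale ?u = ln r"
      using log_cumulant_spec[OF r(1) rs] log_cumulant_strict_mono[of r r1] r r1 by fastforce+
    have "ln ?u - ?u / 2 \<le> ln r"
      using log_scale_near_0(2)[of ?u] u by simp
    then have "ln ?u \<le> ln r + ?u / 2" by simp
    then have "exp (ln ?u) \<le> exp (ln r + ?u / 2)" by (simp only: exp_le_cancel_iff)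
    then have le: "?u \<le> r * exp (?u / 2)" using u r by (simp add: exp_add)
    also have "\<dots> \<le> r * 2"
      using e[of "?u / 2"] u r by (intro mult_left_mono) auto
    finally have le2: "?u \<le> 2 * r" by simp
    have "?u \<le> r * exp (?u / 2)" by (rule le)
    also have "\<dots> \<le> r * (1 + 2 * r)"
    proof (intro mult_left_mono)
      have "exp (?u / 2) \<le> 1 + 2 * (?u / 2)" using u by (intro e) auto
      then show "exp (?u / 2) \<le> 1 + 2 * r" using le2 by linarith
    qed (use r in auto)
    finally show ?thesis using u le2 by (simp add: algebra_simps power2_eq_square)
  qed
  show thesis
  proof
    show "exp (log_cumulant r) \<le> 2" if "0 < r" "r \<le> r1" for r
    proof -
      have "exp (log_cumulant r) \<le> exp (1/2)" using main[OF that] by simp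
      also have "\<dots> \<le> 1 + 2 * (1/2)" by (intro e) auto
      finally show ?thesis by simp
    qed
  qed (use r1 \<open>r1 \<le> 1\<close> main in auto)
qed

text \<open>The function \<open>g a = log_cumulant (exp a)\<close> solves \<open>g'' = exp g - 1\<close>;
  its energy \<open>g'\<^sup>2 / 2 - (exp g - g - 1)\<close> vanishes.\<close>

lemma DERIV_log_cumulant_exp:
  assumes "a < ln r_star"
  shows "((\<lambda>a. log_cumulant (exp a)) has_real_derivative
    sqrt (2 * (exp (log_cumulant (exp a)) - log_cumulant (exp a) - 1))) (at a)"
proof -
  let ?g = "\<lambda>a. log_cumulant (exp a)"
  have sp: "0 < ?g a" "log_scale (?g a) = a" if "a < ln r_star" for a
  proof -
    have "exp a < r_star" using that r_star_pos by (metis exp_less_cancel_iff exp_ln)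
    then show "0 < ?g a" "log_scale (?g a) = a" using log_cumulant_spec[of "exp a"] by simp_all
  qed
  have inv: "?g (log_scale u) = u" if "0 < u" for u
    using log_cumulant_at_exp_log_scale[OF that] by simp
  let ?u = "?g a"
  have u: "0 < ?u" "log_scale ?u = a" using sp[OF assms] by auto
  have "isCont ?g (log_scale ?u)"
    by (rule isCont_inverse_function2[of "?u / 2" _ "?u + 1"])
      (use u in \<open>auto intro!: inv DERIV_isCont[OF DERIV_log_scale]\<close>)
  then have "isCont ?g a" using u by simp
  then have "(?g has_real_derivative inverse (explosion_rate ?u)) (at a)"
    by (intro DERIV_inverse_function[where f = log_scale and a = "a - 1" and b = "ln r_star"])
      (use assms u explosion_rate_pos[OF u(1)] sp in \<open>auto intro!: DERIV_log_scale\<close>)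
  then show ?thesis by (simp add: explosion_rate_def)
qed

lemma measurable_log_cumulant_exp [measurable]:
  assumes "0 < r" "r < r_star"
  shows "(\<lambda>z. indicator {0..} z * (exp (log_cumulant (r * exp (- z))) - 1)) \<in> borel_measurable borel"
proof -
  have "continuous_on {0..} (\<lambda>z. log_cumulant (exp (ln r - z)))"
  proof (rule continuous_at_imp_continuous_on, rule ballI)
    fix z :: real assume "z \<in> {0..}"
    moreover have "ln r < ln r_star" using assms by simp
    ultimately have "ln r - z < ln r_star" by simp
    then have "isCont (\<lambda>a. log_cumulant (exp a)) (ln r - z)"
      by (intro DERIV_isCont[OF DERIV_log_cumulant_exp])
    then show "isCont (\<lambda>z. log_cumulant (exp (ln r - z))) z"
      by (intro isCont_o2[where f = "\<lambda>z. ln r - z" and g = "\<lambda>a. log_cumulant (exp a)"]) (auto intro!: continuous_intros)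
  qed
  then have "continuous_on {0..} (\<lambda>z. log_cumulant (r * exp (- z)))"
    using assms by (simp add: exp_diff exp_minus divide_inverse)
  then have "continuous_on {0..} (\<lambda>z. exp (log_cumulant (r * exp (- z))) - 1)"
    by (intro continuous_intros)
  then show ?thesis
    using borel_measurable_continuous_on_indicator[of "{0..}" "\<lambda>z. exp (log_cumulant (r * exp (- z))) - 1"]
    by simp
qed


text \<open>Integration by parts: with \<open>a = ln r\<close>, the integrand is
  \<open>z * g'' (a - z)\<close>, with primitive \<open>- (z * g' (a - z) + g (a - z))\<close>. This
  primitive is \<open>- g a\<close> at \<open>z = 0\<close> and vanishes at infinity.\<close>

lemma log_cumulant_integral_equation:
  assumes "0 < r" "r < r_star"
  shows "(\<integral>\<^sup>+z. ennreal (z * (exp (log_cumulant (r * exp (- z))) - 1)) * indicator {0..} z \<partial>lborel) =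
    ennreal (log_cumulant r)"
proof -
  let ?g = "\<lambda>a. log_cumulant (exp a)"
  let ?s = "\<lambda>a. sqrt (2 * (exp (?g a) - ?g a - 1))"
  let ?F = "\<lambda>z. - (z * ?s (ln r - z) + ?g (ln r - z))"
  define f where "f z = z * (indicator {0..} z * (exp (log_cumulant (r * exp (- z))) - 1))" for z :: real
  have exp_diff': "exp (ln r - z) = r * exp (- z)" for z
    using assms by (simp add: exp_diff exp_minus divide_inverse)
  have lt: "r * exp (- z) < r_star" if "0 \<le> z" for z
  proof -
    have "r * exp (- z) \<le> r * 1" using that assms by (intro mult_left_mono) auto
    then show ?thesis using assms by linarith
  qed
  have pos: "0 < ?g (ln r - z)" if "0 \<le> z" for z
    unfolding exp_diff' using assms lt[OF that] by (intro log_cumulant_spec) auto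
  have F: "(?F has_real_derivative f z) (at z)" if z: "0 \<le> z" for z
  proof -
    let ?u = "?g (ln r - z)"
    have "ln r < ln r_star" using assms by simp
    then have a: "ln r - z < ln r_star" using z by simp
    have dg: "(?g has_real_derivative ?s (ln r - z)) (at (ln r - z))"
      using a by (rule DERIV_log_cumulant_exp)
    have p: "0 < exp ?u - ?u - 1"
      using pos[OF z] by (rule exp_remainder_pos)
    \<comment> \<open>Differentiating \<open>g' = sqrt (2 * (exp g - g - 1))\<close> and using
      \<open>g'\<close> once more cancels the square root; this recovers
      \<open>g'' = exp g - 1\<close>.\<close>
    have ds: "(?s has_real_derivative exp ?u - 1) (at (ln r - z))"
    proof -
      have "(?s has_real_derivative
          inverse (sqrt (2 * (exp ?u - ?u - 1))) / 2 * (2 * (exp ?u * ?s (ln r - z) - ?s (ln r - z)))) (at (ln r - z))"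
        using p by (auto intro!: derivative_eq_intros dg)
      moreover have "inverse (sqrt (2 * (exp ?u - ?u - 1))) / 2 * (2 * (exp ?u * ?s (ln r - z) - ?s (ln r - z)))
          = exp ?u - 1"
      proof -
        have "sqrt (2 * (exp ?u - ?u - 1)) \<noteq> 0" using p by simp
        then show ?thesis by (simp add: divide_simps) (simp add: algebra_simps)
      qed
      ultimately show ?thesis by (simp only:)
    qed
    have sub: "((\<lambda>z. ln r - z) has_real_derivative - 1) (at z)"
      by (auto intro!: derivative_eq_intros)
    have "((\<lambda>z. ?g (ln r - z)) has_real_derivative ?s (ln r - z) * - 1) (at z)"
      by (rule DERIV_chain2[OF dg sub])
    moreover have "((\<lambda>z. ?s (ln r - z)) has_real_derivative (exp ?u - 1) * - 1) (at z)"
      by (rule DERIV_chain2[OF ds sub])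
    ultimately have "(?F has_real_derivative
        - (1 * ?s (ln r - z) + (exp ?u - 1) * - 1 * z + ?s (ln r - z) * - 1)) (at z)"
      by (intro DERIV_minus DERIV_add DERIV_mult DERIV_ident)
    moreover have "- (1 * ?s (ln r - z) + (exp ?u - 1) * - 1 * z + ?s (ln r - z) * - 1) = f z"
      using z by (simp add: f_def exp_diff' algebra_simps)
    ultimately show ?thesis by simp
  qed
  \<comment> \<open>No boundary term at infinity: both \<open>g (ln r - z)\<close> and its speed are
    of order \<open>exp (- z)\<close> by the bounds near 0.\<close>
  have lim: "(?F \<longlongrightarrow> 0) at_top"
  proof (rule Lim_null_comparison)
    obtain r1 where r1: "0 < r1" "\<And>r. 0 < r \<Longrightarrow> r \<le> r1 \<Longrightarrow> log_cumulant r \<le> 2 * r"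
      "\<And>r. 0 < r \<Longrightarrow> r \<le> r1 \<Longrightarrow> exp (log_cumulant r) \<le> 2"
      by (rule log_cumulant_near_0) blast
    have "((\<lambda>z. r * exp (- z)) \<longlongrightarrow> 0) at_top" using assms by real_asymp
    then have "eventually (\<lambda>z. r * exp (- z) < r1) at_top"
      using r1(1) by (rule order_tendstoD)
    then show "eventually (\<lambda>z. norm (?F z) \<le> z * (4 * r * exp (- z)) + 2 * r * exp (- z)) at_top"
      using eventually_ge_at_top[of 0]
    proof eventually_elim
      case (elim z)
      let ?u = "?g (ln r - z)"
      have u: "0 < ?u" "?u \<le> 2 * (r * exp (- z))" "exp ?u \<le> 2"
        using pos[of z] r1(2,3)[of "r * exp (- z)"] elim assms unfolding exp_diff' by auto
      have "?s (ln r - z) \<le> ?u * exp (?u / 2)"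
        using u by (intro sqrt_exp_remainder_le) auto
      also have "\<dots> \<le> ?u * exp ?u"
        using u by (intro mult_left_mono) auto
      also have "\<dots> \<le> (2 * (r * exp (- z))) * 2"
        using u assms by (intro mult_mono) auto
      finally have "z * ?s (ln r - z) \<le> z * (4 * r * exp (- z))"
        using elim by (intro mult_left_mono) auto
      moreover have "0 \<le> z * ?s (ln r - z)"
        using elim u exp_remainder_pos[OF u(1)] by (intro mult_nonneg_nonneg) auto
      ultimately show ?case using u by simp
    qed
    show "((\<lambda>z. z * (4 * r * exp (- z)) + 2 * r * exp (- z)) \<longlongrightarrow> 0) at_top"
      using assms by real_asymp
  qed
  have "(\<integral>\<^sup>+z. ennreal (f z) * indicator {0..} z \<partial>lborel) = 0 - ?F 0"
  proof (rule nn_integral_FTC_atLeast[OF _ F _ lim])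
    show "f \<in> borel_measurable borel"
      unfolding f_def using assms by measurable
    show "0 \<le> f z" if "0 \<le> z" for z
      using pos[OF that] that unfolding f_def exp_diff' by simp
  qed
  moreover have "ennreal (f z) * indicator {0..} z =
      ennreal (z * (exp (log_cumulant (r * exp (- z))) - 1)) * indicator {0..} z" for z
    by (simp add: f_def indicator_def)
  ultimately show ?thesis using assms by simp
qed

section \<open>Iteration of the cumulant equation\<close>

primrec cumulant_iter :: "nat \<Rightarrow> real \<Rightarrow> ennreal" where
  "cumulant_iter 0 s = ennreal s"
| "cumulant_iter (Suc n) s =
    (\<integral>\<^sup>+z. ennreal z * ennexpm1 (cumulant_iter n (s * exp (- z))) * indicator {0..} z \<partial>lborel)"

lemma measurable_cumulant_iter [measurable]: "cumulant_iter n \<in> borel_measurable borel"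
proof (induction n)
  case 0
  then show ?case by (simp add: fun_eq_iff[symmetric] cong: measurable_cong)
next
  case (Suc n)
  note [measurable] = Suc
  have "(\<lambda>s. cumulant_iter (Suc n) s) \<in> borel_measurable borel" by simp measurable
  then show ?case by simp
qed

text \<open>The operator is monotone, fixes \<open>log_cumulant\<close> and starts below it; the
  arguments \<open>r * exp (- z)\<close> with \<open>z \<ge> 0\<close> remain inside
  \<open>(0, r_star)\<close>.\<close>

lemma cumulant_iter_le:
  assumes "0 < r" "r < r_star"
  shows "cumulant_iter n r \<le> ennreal (log_cumulant r)"
  using assms
proof (induction n arbitrary: r)
  case 0
  then show ?case using log_cumulant_ge[of r] by (auto intro: ennreal_leI)
next
  case (Suc n)
  have "cumulant_iter (Suc n) r \<le>
    (\<integral>\<^sup>+z. ennreal (z * (exp (log_cumulant (r * exp (- z))) - 1)) * indicator {0..} z \<partial>lborel)"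
    unfolding cumulant_iter.simps
  proof (intro nn_integral_mono)
    fix z :: real
    show "ennreal z * ennexpm1 (cumulant_iter n (r * exp (- z))) * indicator {0..} z
      \<le> ennreal (z * (exp (log_cumulant (r * exp (- z))) - 1)) * indicator {0..} z"
    proof (cases "0 \<le> z")
      case True
      have "r * exp (- z) \<le> r * 1" using True Suc.prems by (intro mult_left_mono) auto
      then have r: "0 < r * exp (- z)" "r * exp (- z) < r_star" using Suc.prems by (simp, linarith)
      have "ennexpm1 (cumulant_iter n (r * exp (- z))) \<le> ennexpm1 (ennreal (log_cumulant (r * exp (- z))))"
        using r by (intro ennexpm1_mono Suc.IH)
      also have "\<dots> = ennreal (exp (log_cumulant (r * exp (- z))) - 1)"
        using log_cumulant_spec(1)[OF r] by (intro ennexpm1_ennreal) simp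
      finally show ?thesis
        using True log_cumulant_spec(1)[OF r] by (auto simp: ennreal_mult intro!: mult_left_mono)
    qed simp
  qed
  also have "\<dots> = ennreal (log_cumulant r)"
    using Suc.prems by (rule log_cumulant_integral_equation)
  finally show ?case .
qed

lemma nn_integral_times_exp:
  assumes "0 < q"
  shows "(\<integral>\<^sup>+z. ennreal (z * exp (- q * z)) * indicator {0..} z \<partial>lborel) = ennreal (1 / q\<^sup>2)"
proof -
  let ?F = "\<lambda>z. - (z / q + 1 / q\<^sup>2) * exp (- q * z)"
  have "(\<integral>\<^sup>+z. ennreal (z * exp (- q * z)) * indicator {0..} z \<partial>lborel) = 0 - ?F 0"
  proof (rule nn_integral_FTC_atLeast)
    show "(?F has_real_derivative z * exp (- q * z)) (at z)" for z
      using assms by (auto intro!: derivative_eq_intros simp: power2_eq_square field_simps)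
    show "(?F \<longlongrightarrow> 0) at_top" using assms by real_asymp
  qed auto
  then show ?thesis by simp
qed

text \<open>Powers are eigenfunctions of the linear part of the iteration, with eigenvalue
  \<open>1 / q\<^sup>2\<close>.\<close>

lemma nn_integral_times_exp_power:
  assumes "0 < q" "0 \<le> c" "0 \<le> r"
  shows "(\<integral>\<^sup>+z. ennreal (z * (c * (r * exp (- z)) ^ q)) * indicator {0..} z \<partial>lborel) = ennreal (c * r ^ q / (real q)\<^sup>2)"
proof -
  have "ennreal (z * (c * (r * exp (- z)) ^ q)) * indicator {0..} z =
      ennreal (c * r ^ q) * (ennreal (z * exp (- real q * z)) * indicator {0..} z)" for z
  proof -
    have "(r * exp (- z)) ^ q = r ^ q * exp (- real q * z)"
      by (simp add: power_mult_distrib flip: exp_of_nat_mult)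
    then show ?thesis using assms
      by (auto simp: indicator_def ac_simps simp flip: ennreal_mult)
  qed
  then have "(\<integral>\<^sup>+z. ennreal (z * (c * (r * exp (- z)) ^ q)) * indicator {0..} z \<partial>lborel) =
      ennreal (c * r ^ q) * (\<integral>\<^sup>+z. ennreal (z * exp (- real q * z)) * indicator {0..} z \<partial>lborel)"
    by (simp add: nn_integral_cmult)
  also have "\<dots> = ennreal (c * r ^ q) * ennreal (1 / (real q)\<^sup>2)"
    using assms by (subst nn_integral_times_exp) auto
  also have "\<dots> = ennreal (c * r ^ q / (real q)\<^sup>2)"
    using assms by (simp flip: ennreal_mult)
  finally show ?thesis .
qed

text \<open>The weight \<open>r\<^sup>2 + B r\<^sup>p\<close>, with \<open>p\<close> large, makes the integral operator linearised at
  \<open>log_cumulant\<close> a contraction with factor \<open>1/2\<close> on all of \<open>(0, r0]\<close>.\<close>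

lemma cumulant_iter_contraction:
  assumes r0: "0 < r0" "r0 < r_star"
  obtains C B :: real and p :: nat where "0 \<le> C" "0 \<le> B"
    "\<And>n r. 0 < r \<Longrightarrow> r \<le> r0 \<Longrightarrow>
      ennreal (log_cumulant r) \<le> cumulant_iter n r + ennreal (C / 2 ^ n * (r\<^sup>2 + B * r ^ p))"
proof -
  obtain r1 where r1: "0 < r1" "r1 < r_star"
    "\<And>r. 0 < r \<Longrightarrow> r \<le> r1 \<Longrightarrow> log_cumulant r \<le> r + 2 * r\<^sup>2"
    "\<And>r. 0 < r \<Longrightarrow> r \<le> r1 \<Longrightarrow> exp (log_cumulant r) \<le> 2"
    by (rule log_cumulant_near_0) blast
  define H where "H = exp (log_cumulant r0)"
  \<comment> \<open>Ensures \<open>2 * (1 + H) \<le> p\<^sup>2\<close>. The constant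
    \<open>B\<close> below is chosen so that \<open>B * r ^ m\<close> exceeds \<open>H\<close> for
    \<open>r \<ge> r1\<close>.\<close>
  define m where "m = nat \<lceil>2 * (1 + H)\<rceil>"
  define p where "p = m + 2"
  define B where "B = H / r1 ^ m"
  \<comment> \<open>Covers the initial gap \<open>log_cumulant r - r\<close>: it is at most
    \<open>2 * r\<^sup>2\<close> up to \<open>r1\<close>, and at most \<open>log_cumulant r0\<close>
    beyond, where \<open>r\<^sup>2 / r1\<^sup>2 \<ge> 1\<close>.\<close>
  define C where "C = 2 + log_cumulant r0 / r1\<^sup>2"
  define w where "w r = r\<^sup>2 + B * r ^ p" for r
  have H: "0 < H" by (simp add: H_def)
  have B: "0 \<le> B" using H r1 by (simp add: B_def)
  have L0: "0 < log_cumulant r0" using log_cumulant_spec(1)[OF r0] .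
  have C: "0 \<le> C" using L0 r1 by (simp add: C_def)
  have w: "r\<^sup>2 \<le> w r" "0 \<le> w r" if "0 < r" for r
    using B that by (auto simp: w_def)
  have Gle: "log_cumulant r \<le> log_cumulant r0" if "0 < r" "r \<le> r0" for r
    using log_cumulant_strict_mono[of r r0] that r0 by (cases "r = r0") auto
  have "2 * (1 + H) \<le> real m" unfolding m_def by linarith
  also have "\<dots> \<le> (real p)\<^sup>2" unfolding p_def
    by (simp add: power2_eq_square algebra_simps)
  finally have p: "2 * (1 + H) \<le> (real p)\<^sup>2" .
  have p0: "0 < p" by (simp add: p_def)
  have hw: "exp (log_cumulant r) * w r \<le> 2 * r ^ 2 + B * (1 + H) * r ^ p" if r: "0 < r" "r \<le> r0" for r
  proof -
    let ?h = "exp (log_cumulant r)"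
    have hH: "?h \<le> H" using Gle[OF r] by (simp add: H_def)
    \<comment> \<open>One bound for both regimes, 2 near 0 and \<open>H\<close> beyond
      \<open>r1\<close>. Its term \<open>B * r ^ m\<close> times \<open>r\<^sup>2\<close> is again a
      multiple of \<open>r ^ p\<close>, because \<open>p = m + 2\<close>; hence the factor
      \<open>1 + H\<close>.\<close>
    have h: "?h \<le> 2 + B * r ^ m"
    proof (cases "r \<le> r1")
      case True
      then have "?h \<le> 2" using r1(4) r by simp
      moreover have "0 \<le> B * r ^ m" using B r by simp
      ultimately show ?thesis by linarith
    next
      case False
      then have "r1 ^ m \<le> r ^ m" using r1 by (intro power_mono) auto
      then have "H \<le> B * r ^ m" using H r1 by (simp add: B_def field_simps)
      then show ?thesis using hH by linarith
    qed
    have "?h * w r = ?h * r\<^sup>2 + ?h * (B * r ^ p)" by (simp add: w_def algebra_simps)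
    also have "\<dots> \<le> (2 + B * r ^ m) * r\<^sup>2 + H * (B * r ^ p)"
      using h hH B r by (intro add_mono mult_right_mono) auto
    also have "\<dots> = 2 * r ^ 2 + B * (1 + H) * r ^ p"
      by (simp add: p_def power_add algebra_simps power2_eq_square)
    finally show ?thesis .
  qed
  have main: "ennreal (log_cumulant r) \<le> cumulant_iter n r + ennreal (C / 2 ^ n * w r)" if "0 < r" "r \<le> r0" for n r
    using that
  proof (induction n arbitrary: r)
    case 0
    have "log_cumulant r \<le> r + C * w r"
    proof (cases "r \<le> r1")
      case True
      have "2 * r\<^sup>2 \<le> C * w r"
        using w[of r] 0 C L0 r1 by (intro mult_mono) (auto simp: C_def)
      then show ?thesis using r1(3)[OF 0(1) True] by linarith
    next
      case False
      then have "r1\<^sup>2 \<le> r\<^sup>2" using r1 by (intro power_mono) auto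
      then have "log_cumulant r0 \<le> log_cumulant r0 / r1\<^sup>2 * r\<^sup>2"
        using L0 r1 by (simp add: field_simps)
      also have "\<dots> \<le> C * w r"
        using w[of r] 0 L0 C by (intro mult_mono) (auto simp: C_def)
      finally show ?thesis using Gle[OF 0] 0 by linarith
    qed
    then have "ennreal (log_cumulant r) \<le> ennreal (r + C * w r)" by (rule ennreal_leI)
    also have "\<dots> = ennreal r + ennreal (C * w r)"
      using 0 C w[of r] by (intro ennreal_plus) auto
    finally show ?case by simp
  next
    case (Suc n)
    let ?G = "\<lambda>z. log_cumulant (r * exp (- z))"
    define D where "D = C / 2 ^ n"
    have D: "0 \<le> D" using C by (simp add: D_def)
    have "ennreal (log_cumulant r) = (\<integral>\<^sup>+z. ennreal (z * (exp (?G z) - 1)) * indicator {0..} z \<partial>lborel)"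
      using Suc.prems r0 by (intro log_cumulant_integral_equation[symmetric]) auto
    also have "\<dots> \<le> (\<integral>\<^sup>+z. ennreal z * ennexpm1 (cumulant_iter n (r * exp (- z))) * indicator {0..} z
        + (ennreal (z * (2 * D * (r * exp (- z)) ^ 2)) * indicator {0..} z
        + ennreal (z * (D * B * (1 + H) * (r * exp (- z)) ^ p)) * indicator {0..} z) \<partial>lborel)"
    proof (intro nn_integral_mono)
      fix z :: real
      show "ennreal (z * (exp (?G z) - 1)) * indicator {0..} z \<le>
        ennreal z * ennexpm1 (cumulant_iter n (r * exp (- z))) * indicator {0..} z
        + (ennreal (z * (2 * D * (r * exp (- z)) ^ 2)) * indicator {0..} z
        + ennreal (z * (D * B * (1 + H) * (r * exp (- z)) ^ p)) * indicator {0..} z)"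
      proof (cases "0 \<le> z")
        case z: True
        let ?r = "r * exp (- z)"
        have "r * exp (- z) \<le> r * 1" using z Suc.prems by (intro mult_left_mono) auto
        then have r: "0 < ?r" "?r \<le> r0" using Suc.prems by (simp, linarith)
        have rs: "?r < r_star" using r r0 by linarith
        have G: "0 < ?G z" using log_cumulant_spec(1)[OF r(1) rs] .
        have "cumulant_iter n ?r \<le> ennreal (?G z)" by (rule cumulant_iter_le[OF r(1) rs])
        then obtain x where x: "cumulant_iter n ?r = ennreal x" "0 \<le> x" "x \<le> ?G z"
          using G by (cases "cumulant_iter n ?r") (auto simp: top_unique)
        have "ennreal (?G z) \<le> ennreal x + ennreal (D * w ?r)"
          using Suc.IH[OF r] x by (simp add: D_def)
        also have "\<dots> = ennreal (x + D * w ?r)"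
          using x D w[OF r(1)] by (intro ennreal_plus[symmetric] mult_nonneg_nonneg) auto
        finally have "?G z \<le> x + D * w ?r"
          using x D w[OF r(1)] by (subst (asm) ennreal_le_iff) (auto intro!: add_nonneg_nonneg)
        then have "?G z - x \<le> D * w ?r" by simp
        then have "exp (?G z) * (?G z - x) \<le> exp (?G z) * (D * w ?r)"
          by (intro mult_left_mono) auto
        also have "\<dots> = D * (exp (?G z) * w ?r)" by simp
        also have "\<dots> \<le> D * (2 * ?r ^ 2 + B * (1 + H) * ?r ^ p)"
          using hw[OF r] D by (intro mult_left_mono)
        finally have 1: "exp (?G z) * (?G z - x) \<le> D * (2 * ?r ^ 2 + B * (1 + H) * ?r ^ p)" .
        \<comment> \<open>Tangent line of \<open>exp\<close> at the fixed point: the error is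
          multiplied by at most \<open>exp (?G z)\<close>, whatever the current iterate is.\<close>
        have "exp (?G z) * (1 + (x - ?G z)) \<le> exp (?G z) * exp (x - ?G z)"
          by (intro mult_left_mono exp_ge_add_one_self) auto
        also have "\<dots> = exp x" by (simp add: exp_diff)
        finally have "exp (?G z) - exp x \<le> exp (?G z) * (?G z - x)" by (simp add: algebra_simps)
        from order_trans[OF this 1]
        have "exp (?G z) - 1 \<le> (exp x - 1) + D * (2 * ?r ^ 2 + B * (1 + H) * ?r ^ p)" by simp
        then have "z * (exp (?G z) - 1) \<le> z * ((exp x - 1) + D * (2 * ?r ^ 2 + B * (1 + H) * ?r ^ p))"
          using z by (intro mult_left_mono)
        also have "\<dots> = z * (exp x - 1) + (z * (2 * D * ?r ^ 2) + z * (D * B * (1 + H) * ?r ^ p))"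
          by (simp add: algebra_simps)
        finally have "ennreal (z * (exp (?G z) - 1)) \<le> ennreal (z * (exp x - 1) + (z * (2 * D * ?r ^ 2) + z * (D * B * (1 + H) * ?r ^ p)))"
          by (rule ennreal_leI)
        also have "\<dots> = ennreal z * ennreal (exp x - 1) + (ennreal (z * (2 * D * ?r ^ 2)) + ennreal (z * (D * B * (1 + H) * ?r ^ p)))"
        proof -
          have nonneg: "0 \<le> exp x - 1" "0 \<le> z * (2 * D * ?r ^ 2)" "0 \<le> z * (D * B * (1 + H) * ?r ^ p)"
            using z x D r B H by simp_all
          show ?thesis
            unfolding ennreal_mult[OF z nonneg(1), symmetric] ennreal_plus[OF nonneg(2,3), symmetric]
            by (rule ennreal_plus[OF mult_nonneg_nonneg[OF z nonneg(1)] add_nonneg_nonneg[OF nonneg(2,3)]])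
        qed
        finally show ?thesis
          unfolding x(1) ennexpm1_ennreal[OF x(2)] using z by simp
      qed simp
    qed
    also have "\<dots> = cumulant_iter (Suc n) r +
      ((\<integral>\<^sup>+z. ennreal (z * (2 * D * (r * exp (- z)) ^ 2)) * indicator {0..} z \<partial>lborel) +
       (\<integral>\<^sup>+z. ennreal (z * (D * B * (1 + H) * (r * exp (- z)) ^ p)) * indicator {0..} z \<partial>lborel))"
      by (subst nn_integral_add, measurable, subst nn_integral_add) auto
    also have "\<dots> = cumulant_iter (Suc n) r +
      (ennreal (2 * D * r ^ 2 / (real 2)\<^sup>2) + ennreal (D * B * (1 + H) * r ^ p / (real p)\<^sup>2))"
      using p0 D B H Suc.prems by (subst (1 2) nn_integral_times_exp_power) auto
    also have "\<dots> \<le> cumulant_iter (Suc n) r + ennreal (C / 2 ^ Suc n * w r)"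
    proof (intro add_left_mono)
      \<comment> \<open>Both parts of the weight are halved: the quadratic one by
        \<open>2 / 4\<close>, the power \<open>p\<close> by
        \<open>(1 + H) / p\<^sup>2 \<le> 1 / 2\<close>.\<close>
      have "(1 + H) / (real p)\<^sup>2 \<le> 1 / 2" using p p0 by (simp add: field_simps)
      then have "(D * B * r ^ p) * ((1 + H) / (real p)\<^sup>2) \<le> (D * B * r ^ p) * (1 / 2)"
        using D B Suc.prems by (intro mult_left_mono) auto
      moreover have "2 * D * r ^ 2 / (real 2)\<^sup>2 = D * r\<^sup>2 * (1 / 2)"
        by simp
      moreover have "D * B * (1 + H) * r ^ p / (real p)\<^sup>2 = (D * B * r ^ p) * ((1 + H) / (real p)\<^sup>2)"
        by simp
      moreover have "C / 2 ^ Suc n * w r = D * r\<^sup>2 * (1 / 2) + (D * B * r ^ p) * (1 / 2)"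
        by (simp add: w_def D_def distrib_left add_divide_distrib)
      ultimately have le: "2 * D * r ^ 2 / (real 2)\<^sup>2 + D * B * (1 + H) * r ^ p / (real p)\<^sup>2 \<le> C / 2 ^ Suc n * w r"
        by linarith
      have nonneg: "0 \<le> 2 * D * r ^ 2 / (real 2)\<^sup>2" "0 \<le> D * B * (1 + H) * r ^ p / (real p)\<^sup>2"
        using D B H Suc.prems by simp_all
      show "ennreal (2 * D * r ^ 2 / (real 2)\<^sup>2) + ennreal (D * B * (1 + H) * r ^ p / (real p)\<^sup>2)
        \<le> ennreal (C / 2 ^ Suc n * w r)"
        unfolding ennreal_plus[OF nonneg, symmetric] by (rule ennreal_leI[OF le])
    qed
    finally show ?case .
  qed
  show thesis
    by (rule that[OF C B main[unfolded w_def]])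
qed

lemma cumulant_iter_tendsto:
  assumes "0 < r" "r < r_star"
  shows "(\<lambda>n. cumulant_iter n r) \<longlonglongrightarrow> ennreal (log_cumulant r)"
proof -
  obtain C B :: real and p :: nat where C: "0 \<le> C" "0 \<le> B"
    and le: "\<And>n. ennreal (log_cumulant r) \<le> cumulant_iter n r + ennreal (C / 2 ^ n * (r\<^sup>2 + B * r ^ p))"
    by (rule cumulant_iter_contraction[OF assms]) (use assms in blast)
  define K where "K = C * (r\<^sup>2 + B * r ^ p)"
  have K: "0 \<le> K" using C assms by (simp add: K_def)
  have lower: "ennreal (log_cumulant r - K / 2 ^ n) \<le> cumulant_iter n r" for n
  proof -
    have "C / 2 ^ n * (r\<^sup>2 + B * r ^ p) = K / 2 ^ n" by (simp add: K_def)
    then have "ennreal (log_cumulant r) - ennreal (K / 2 ^ n) \<le> cumulant_iter n r"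
      using le[of n] by (simp add: ennreal_minus_le_iff add.commute)
    then show ?thesis using K by (simp add: ennreal_minus)
  qed
  have lim: "(\<lambda>n. ennreal (log_cumulant r - K / 2 ^ n)) \<longlonglongrightarrow> ennreal (log_cumulant r)"
    using tendsto_diff[OF tendsto_const LIMSEQ_divide_realpow_zero[of 2 K], of "log_cumulant r"]
    by (intro tendsto_ennrealI) simp
  show ?thesis
    by (rule tendsto_sandwich[OF _ _ lim tendsto_const])
      (simp_all add: lower cumulant_iter_le assms)
qed

section \<open>Exponential formula and moments of the Poisson process\<close>

lemma measurable_quadrant [measurable]: "quadrant \<in> sets borel"
  unfolding quadrant_def by (intro borel_open open_Times) auto

lemma poisson_ppD:
  assumes "poisson_pp_lebesgue M \<xi>"
  shows poisson_pp_measurable: "\<xi> \<in> M \<rightarrow>\<^sub>M (\<Pi>\<^sub>M k\<in>UNIV. borel)"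
    and poisson_pp_quadrant: "AE \<omega> in M. \<forall>k. \<xi> \<omega> k \<in> quadrant"
    and poisson_pp_finite: "\<And>A. A \<in> sets lborel \<Longrightarrow> A \<subseteq> quadrant \<Longrightarrow> emeasure lborel A < \<infinity> \<Longrightarrow>
      AE \<omega> in M. finite {k. \<xi> \<omega> k \<in> A}"
    and poisson_pp_prob: "\<And>A j. A \<in> sets lborel \<Longrightarrow> A \<subseteq> quadrant \<Longrightarrow> emeasure lborel A < \<infinity> \<Longrightarrow>
      measure M {\<omega> \<in> space M. pp_count \<xi> A \<omega> = j} = measure lborel A ^ j / fact j * exp (- measure lborel A)"
    and poisson_pp_indep: "\<And>(A :: nat \<Rightarrow> (real \<times> real) set) I. finite I \<Longrightarrow> disjoint_family_on A I \<Longrightarrow>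
      (\<And>i. i \<in> I \<Longrightarrow> A i \<in> sets lborel \<and> A i \<subseteq> quadrant \<and> emeasure lborel (A i) < \<infinity>) \<Longrightarrow>
      prob_space.indep_vars M (\<lambda>_. count_space UNIV) (\<lambda>i. pp_count \<xi> (A i)) I"
proof -
  note D = assms[unfolded poisson_pp_lebesgue_def]
  show "\<xi> \<in> M \<rightarrow>\<^sub>M (\<Pi>\<^sub>M k\<in>UNIV. borel)" by (rule D[THEN conjunct1])
  show "AE \<omega> in M. \<forall>k. \<xi> \<omega> k \<in> quadrant" by (rule D[THEN conjunct2, THEN conjunct1])
  show "AE \<omega> in M. finite {k. \<xi> \<omega> k \<in> A}"
    "measure M {\<omega> \<in> space M. pp_count \<xi> A \<omega> = j} = measure lborel A ^ j / fact j * exp (- measure lborel A)"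
    if "A \<in> sets lborel" "A \<subseteq> quadrant" "emeasure lborel A < \<infinity>" for A j
    using D[THEN conjunct2, THEN conjunct2, THEN conjunct1, rule_format, OF conjI, OF that(1) conjI, OF that(2,3)]
    by (blast, blast)
  show "prob_space.indep_vars M (\<lambda>_. count_space UNIV) (\<lambda>i. pp_count \<xi> (A i)) I"
    if "finite I" "disjoint_family_on A I"
      "\<And>i. i \<in> I \<Longrightarrow> A i \<in> sets lborel \<and> A i \<subseteq> quadrant \<and> emeasure lborel (A i) < \<infinity>"
    for A :: "nat \<Rightarrow> (real \<times> real) set" and I
    using D[THEN conjunct2, THEN conjunct2, THEN conjunct2, THEN spec, of A, THEN spec, of I, THEN mp] that by blast
qed

lemma poisson_pp_component [measurable]:
  assumes "poisson_pp_lebesgue M \<xi>"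
  shows "(\<lambda>\<omega>. \<xi> \<omega> k) \<in> borel_measurable M"
  using measurable_compose[OF poisson_pp_measurable[OF assms] measurable_component_singleton[of k]] by simp

text \<open>Probability generating function of a Poisson variable at \<open>1 + c\<close>, obtained
  by summing over the value of the count.\<close>

lemma nn_integral_power_pp_count:
  assumes "prob_space M" and pp: "poisson_pp_lebesgue M \<xi>"
    and A: "A \<in> sets lborel" "A \<subseteq> quadrant" "emeasure lborel A < \<infinity>" and c: "0 \<le> c"
  shows "(\<integral>\<^sup>+\<omega>. ennreal ((1 + c) ^ pp_count \<xi> A \<omega>) \<partial>M) = ennreal (exp (c * measure lborel A))"
proof -
  interpret prob_space M by fact
  \<comment> \<open>Independence over a single index is used to extract measurability of the
    count.\<close>
  have "indep_vars (\<lambda>_. count_space UNIV) (\<lambda>i. pp_count \<xi> A) {0::nat}"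
    using A by (intro poisson_pp_indep[OF pp]) (auto simp: disjoint_family_on_def)
  then have [measurable]: "pp_count \<xi> A \<in> M \<rightarrow>\<^sub>M count_space UNIV"
    by (auto simp: indep_vars_def)
  let ?l = "measure lborel A"
  have "(\<integral>\<^sup>+\<omega>. ennreal ((1 + c) ^ pp_count \<xi> A \<omega>) \<partial>M) =
    (\<integral>\<^sup>+\<omega>. (\<Sum>j. ennreal ((1 + c) ^ j) * indicator {\<omega> \<in> space M. pp_count \<xi> A \<omega> = j} \<omega>) \<partial>M)"
    by (intro nn_integral_cong suminf_cmult_indicator[symmetric]) (auto simp: disjoint_family_on_def)
  also have "\<dots> = (\<Sum>j. ennreal ((1 + c) ^ j) * emeasure M {\<omega> \<in> space M. pp_count \<xi> A \<omega> = j})"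
    by (subst nn_integral_suminf) (auto intro!: suminf_cong nn_integral_cmult_indicator)
  also have "\<dots> = (\<Sum>j. ennreal (exp (- ?l) * (((1 + c) * ?l) ^ j /\<^sub>R fact j)))"
    using c by (intro suminf_cong)
      (simp add: emeasure_eq_measure poisson_pp_prob[OF pp A] power_mult_distrib divide_inverse ac_simps flip: ennreal_mult)
  also have "\<dots> = ennreal (exp (- ?l) * exp ((1 + c) * ?l))"
    using c by (intro suminf_ennreal_eq sums_mult exp_converges) simp
  also have "exp (- ?l) * exp ((1 + c) * ?l) = exp (c * ?l)"
    by (simp add: algebra_simps flip: exp_add)
  finally show ?thesis .
qed

lemma incseq_prod_one_plus: "incseq (\<lambda>K. \<Prod>k<K. 1 + (f k :: ennreal))"
proof (rule incseq_SucI)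
  fix K
  show "(\<Prod>k<K. 1 + f k) \<le> (\<Prod>k<Suc K. 1 + f k)"
    using mult_left_mono[of 1 "1 + f K" "\<Prod>k<K. 1 + f k"] by simp
qed

text \<open>Atoms are grouped by the nonzero values \<open>e i\<close> of \<open>s\<close>: the
  product over atoms becomes the product of \<open>(1 + e i) ^ pp_count\<close> over the level sets
  \<open>A i\<close>, whose counts are independent Poisson variables.\<close>

lemma nn_integral_pp_prod_simple:
  fixes s :: "real \<times> real \<Rightarrow> real"
  assumes "prob_space M" and pp: "poisson_pp_lebesgue M \<xi>"
    and s[measurable]: "s \<in> borel_measurable borel" and fin: "finite (range s)" and nonneg: "\<And>x. 0 \<le> s x"
    and supp: "{x. s x \<noteq> 0} \<subseteq> quadrant" "emeasure lborel {x. s x \<noteq> 0} < \<infinity>"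
  shows "(\<integral>\<^sup>+\<omega>. (SUP K. \<Prod>k<K. 1 + ennreal (s (\<xi> \<omega> k))) \<partial>M) = ennexp (\<integral>\<^sup>+x. ennreal (s x) \<partial>lborel)"
proof -
  interpret prob_space M by fact
  obtain e :: "nat \<Rightarrow> real" where e: "bij_betw e {..<card (range s - {0})} (range s - {0})"
    using ex_bij_betw_nat_finite[of "range s - {0}"] fin by (auto simp: atLeast0LessThan)
  define I where "I = {..<card (range s - {0})}"
  define A where "A i = {x. s x = e i}" for i
  have I: "finite I" by (simp add: I_def)
  have e_bij: "bij_betw e I (range s - {0})" using e by (simp add: I_def)
  have e_pos: "0 \<le> e i" "e i \<noteq> 0" if "i \<in> I" for i
  proof -
    have "e i \<in> range s - {0}" using e_bij that by (auto simp: bij_betw_def)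
    then show "0 \<le> e i" "e i \<noteq> 0" using nonneg by auto
  qed
  have A_sub: "A i \<subseteq> {x. s x \<noteq> 0}" if "i \<in> I" for i
    using e_pos[OF that] by (auto simp: A_def)
  have "s -` {y} \<inter> space borel \<in> sets borel" for y by (rule measurable_sets[OF s]) simp
  then have A_sets[measurable]: "A i \<in> sets borel" for i
    by (simp add: A_def vimage_def)
  have A: "A i \<in> sets lborel" "A i \<subseteq> quadrant" "emeasure lborel (A i) < \<infinity>" if "i \<in> I" for i
  proof -
    have "{x. s x \<noteq> 0} \<in> sets lborel" by measurable
    then have "emeasure lborel (A i) \<le> emeasure lborel {x. s x \<noteq> 0}"
      using A_sub[OF that] by (intro emeasure_mono) auto
    then show "A i \<in> sets lborel" "A i \<subseteq> quadrant" "emeasure lborel (A i) < \<infinity>"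
      using supp A_sub[OF that] by auto
  qed
  have disj: "disjoint_family_on A I"
    using bij_betw_imp_inj_on[OF e_bij] by (auto simp: disjoint_family_on_def A_def inj_on_def)
  have prod_eq: "1 + ennreal (s x) = (\<Prod>i\<in>I. if x \<in> A i then ennreal (1 + e i) else 1)" for x
  proof -
    have "(\<Prod>i\<in>I. if x \<in> A i then ennreal (1 + e i) else 1) = (\<Prod>i\<in>I. (\<lambda>v. if v = s x then ennreal (1 + v) else 1) (e i))"
      by (intro prod.cong) (auto simp: A_def)
    also have "\<dots> = (\<Prod>v\<in>range s - {0}. if v = s x then ennreal (1 + v) else 1)"
      by (rule prod.reindex_bij_betw[OF e_bij])
    also have "\<dots> = 1 + ennreal (s x)"
      using fin nonneg[of x] by (simp add: prod.delta')
    finally show ?thesis by simp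
  qed
  have sum_eq: "ennreal (s x) = (\<Sum>i\<in>I. ennreal (e i) * indicator (A i) x)" for x
  proof -
    have "(\<Sum>i\<in>I. ennreal (e i) * indicator (A i) x) = (\<Sum>i\<in>I. (\<lambda>v. if v = s x then ennreal v else 0) (e i))"
      by (intro sum.cong) (auto simp: A_def)
    also have "\<dots> = (\<Sum>v\<in>range s - {0}. if v = s x then ennreal v else 0)"
      by (rule sum.reindex_bij_betw[OF e_bij])
    also have "\<dots> = ennreal (s x)"
      using fin by (simp add: sum.delta')
    finally show ?thesis by simp
  qed
  have "AE \<omega> in M. \<forall>i\<in>I. finite {k. \<xi> \<omega> k \<in> A i}"
    using I A by (intro AE_finite_allI poisson_pp_finite[OF pp]) auto
  then have "AE \<omega> in M. (SUP K. \<Prod>k<K. 1 + ennreal (s (\<xi> \<omega> k))) = (\<Prod>i\<in>I. ennreal ((1 + e i) ^ pp_count \<xi> (A i) \<omega>))"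
  proof eventually_elim
    case (elim \<omega>)
    \<comment> \<open>Only finitely many labels carry an atom in the support of \<open>s\<close>;
      beyond \<open>K0\<close> every factor is 1 and the partial products are constant.\<close>
    have "finite (\<Union>i\<in>I. {k. \<xi> \<omega> k \<in> A i})" using elim I by auto
    then obtain K0 where K0: "\<And>k. k \<in> (\<Union>i\<in>I. {k. \<xi> \<omega> k \<in> A i}) \<Longrightarrow> k < K0"
      by (meson bounded_nat_set_is_finite finite_nat_set_iff_bounded)
    have "(\<Prod>k<K. 1 + ennreal (s (\<xi> \<omega> k))) = (\<Prod>i\<in>I. ennreal ((1 + e i) ^ pp_count \<xi> (A i) \<omega>))" if "K0 \<le> K" for K
    proof -
      have "(\<Prod>k<K. 1 + ennreal (s (\<xi> \<omega> k))) = (\<Prod>i\<in>I. \<Prod>k<K. if \<xi> \<omega> k \<in> A i then ennreal (1 + e i) else 1)"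
        unfolding prod_eq by (rule prod.swap)
      also have "\<dots> = (\<Prod>i\<in>I. ennreal ((1 + e i) ^ pp_count \<xi> (A i) \<omega>))"
      proof (intro prod.cong refl)
        fix i assume i: "i \<in> I"
        have eq: "{k. \<xi> \<omega> k \<in> A i} = {k \<in> {..<K}. \<xi> \<omega> k \<in> A i}"
          using K0 that i by fastforce
        have "(\<Prod>k<K. if \<xi> \<omega> k \<in> A i then ennreal (1 + e i) else 1) = (\<Prod>k\<in>{k \<in> {..<K}. \<xi> \<omega> k \<in> A i}. ennreal (1 + e i))"
          by (rule prod.inter_filter[symmetric]) simp
        also have "\<dots> = ennreal ((1 + e i) ^ pp_count \<xi> (A i) \<omega>)"
          using e_pos[OF i] by (simp add: pp_count_def eq ennreal_power del: ennreal_plus)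
        finally show "(\<Prod>k<K. if \<xi> \<omega> k \<in> A i then ennreal (1 + e i) else 1) = ennreal ((1 + e i) ^ pp_count \<xi> (A i) \<omega>)" .
      qed
      finally show ?thesis .
    qed
    then have "(\<lambda>K. \<Prod>k<K. 1 + ennreal (s (\<xi> \<omega> k))) \<longlonglongrightarrow> (\<Prod>i\<in>I. ennreal ((1 + e i) ^ pp_count \<xi> (A i) \<omega>))"
      by (intro tendsto_eventually) (auto simp: eventually_sequentially)
    moreover have "incseq (\<lambda>K. \<Prod>k<K. 1 + ennreal (s (\<xi> \<omega> k)))"
      by (rule incseq_prod_one_plus)
    ultimately show ?case using LIMSEQ_SUP LIMSEQ_unique by blast
  qed
  then have "(\<integral>\<^sup>+\<omega>. (SUP K. \<Prod>k<K. 1 + ennreal (s (\<xi> \<omega> k))) \<partial>M) =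
      (\<integral>\<^sup>+\<omega>. (\<Prod>i\<in>I. ennreal ((1 + e i) ^ pp_count \<xi> (A i) \<omega>)) \<partial>M)"
    by (rule nn_integral_cong_AE)
  also have "\<dots> = (\<Prod>i\<in>I. \<integral>\<^sup>+\<omega>. ennreal ((1 + e i) ^ pp_count \<xi> (A i) \<omega>) \<partial>M)"
  proof (rule indep_vars_nn_integral[OF I])
    show "indep_vars (\<lambda>_. borel) (\<lambda>i \<omega>. ennreal ((1 + e i) ^ pp_count \<xi> (A i) \<omega>)) I"
      by (rule indep_vars_compose2[OF poisson_pp_indep[OF pp I disj]]) (use A in auto)
  qed simp
  also have "\<dots> = (\<Prod>i\<in>I. ennexp (ennreal (e i) * emeasure lborel (A i)))"
  proof (intro prod.cong refl)
    fix i assume i: "i \<in> I"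
    have "ennreal (e i) * emeasure lborel (A i) = ennreal (e i * measure lborel (A i))"
      using A(3)[OF i] e_pos[OF i] by (simp add: emeasure_eq_ennreal_measure ennreal_mult less_top[symmetric])
    then show "(\<integral>\<^sup>+\<omega>. ennreal ((1 + e i) ^ pp_count \<xi> (A i) \<omega>) \<partial>M) = ennexp (ennreal (e i) * emeasure lborel (A i))"
      using nn_integral_power_pp_count[OF prob_space_axioms pp A[OF i] e_pos(1)[OF i]] e_pos[OF i]
      by (simp add: ennexp_ennreal)
  qed
  also have "\<dots> = ennexp (\<Sum>i\<in>I. ennreal (e i) * emeasure lborel (A i))"
    by (rule ennexp_sum[OF I, symmetric])
  also have "(\<Sum>i\<in>I. ennreal (e i) * emeasure lborel (A i)) = (\<integral>\<^sup>+x. ennreal (s x) \<partial>lborel)"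
    unfolding sum_eq by (subst nn_integral_sum) (auto simp: nn_integral_cmult_indicator)
  finally show ?thesis .
qed

lemma prod_one_plus_mono:
  fixes f g :: "'b \<Rightarrow> ennreal"
  assumes "\<And>k. k \<in> A \<Longrightarrow> f k \<le> g k"
  shows "(\<Prod>k\<in>A. 1 + f k) \<le> (\<Prod>k\<in>A. 1 + g k)"
  using assms by (induction A rule: infinite_finite_induct) (auto intro!: mult_mono add_left_mono)

text \<open>Multiplication on \<open>ennreal\<close> is discontinuous at
  \<open>0 * \<infinity>\<close>; factors \<open>1 + g\<close> are at least 1 and avoid that
  point.\<close>

lemma prod_one_plus_SUP:
  fixes g :: "nat \<Rightarrow> 'b \<Rightarrow> ennreal"
  assumes "\<And>k. incseq (\<lambda>i. g i k)" "finite A"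
  shows "(\<Prod>k\<in>A. 1 + (SUP i. g i k)) = (SUP i. \<Prod>k\<in>A. 1 + g i k)"
proof -
  have ge1: "1 \<le> (\<Prod>k\<in>A. 1 + (f k::ennreal))" for f and A :: "'b set"
    by (rule prod_ge_1) simp
  have "(\<lambda>i. \<Prod>k\<in>A. 1 + g i k) \<longlonglongrightarrow> (\<Prod>k\<in>A. 1 + (SUP i. g i k))"
    using assms(2)
  proof (induction rule: finite_induct)
    case (insert a A)
    have "(\<lambda>i. (1 + g i a) * (\<Prod>k\<in>A. 1 + g i k)) \<longlonglongrightarrow> (1 + (SUP i. g i a)) * (\<Prod>k\<in>A. 1 + (SUP i. g i k))"
    proof (rule tendsto_mult_ennreal)
      show "(\<lambda>i. 1 + g i a) \<longlonglongrightarrow> 1 + (SUP i. g i a)"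
        by (intro tendsto_intros LIMSEQ_SUP assms)
      show "\<not> ((1 + (SUP i. g i a) = 0 \<and> (\<Prod>k\<in>A. 1 + (SUP i. g i k)) = \<infinity>)
         \<or> (1 + (SUP i. g i a) = \<infinity> \<and> (\<Prod>k\<in>A. 1 + (SUP i. g i k)) = 0))"
        using ge1[where A = A and f = "\<lambda>k. SUP i. g i k"] by auto
    qed (rule insert.IH)
    then show ?case using insert.hyps by simp
  qed simp
  moreover have "incseq (\<lambda>i. \<Prod>k\<in>A. 1 + g i k)"
    unfolding incseq_def using assms(1)[THEN incseqD]
    by (intro allI impI prod_one_plus_mono) auto
  ultimately show ?thesis using LIMSEQ_SUP LIMSEQ_unique by blast
qed

text \<open>With factors \<open>1 + h\<close> everything stays in \<open>[0, \<infinity>]\<close>, so that the formula extends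
  to all measurable \<open>h\<close>, including those with infinite integral, by monotone convergence.\<close>

lemma nn_integral_pp_prod:
  fixes h :: "real \<times> real \<Rightarrow> ennreal"
  assumes "prob_space M" and pp: "poisson_pp_lebesgue M \<xi>"
    and [measurable]: "h \<in> borel_measurable borel"
  shows "(\<integral>\<^sup>+\<omega>. (SUP K. \<Prod>k<K. 1 + h (\<xi> \<omega> k)) \<partial>M) = ennexp (\<integral>\<^sup>+z. h z * indicator quadrant z \<partial>lborel)"
proof -
  define h' where "h' z = h z * indicator quadrant z" for z
  have [measurable]: "h' \<in> borel_measurable borel" unfolding h'_def by measurable
  obtain t where t: "\<And>i. simple_function borel (t i)" "incseq t" "\<And>i x. t i x < \<top>" "\<And>x. (SUP i. t i x) = h' x"
    by (rule borel_measurable_implies_simple_function_sequence'[of h' borel]) auto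
  have [measurable]: "t i \<in> borel_measurable borel" for i
    using t(1) by (rule borel_measurable_simple_function)
  have [measurable]: "cball (0 :: real \<times> real) c \<in> sets borel" for c
    by (rule borel_closed) simp
  have t_mono: "t i x \<le> t j x" if "i \<le> j" for i j x
    using t(2) that unfolding incseq_def le_fun_def by blast
  \<comment> \<open>A simple function may be nonzero on a set of infinite measure; cutting it off
    outside growing balls gives the finite-measure support required by the simple case.\<close>
  define g where "g i x = t i x * indicator (cball 0 (real i)) x" for i x
  have g_inc: "incseq (\<lambda>i. g i x)" for x
    unfolding g_def incseq_def using t_mono by (auto intro!: mult_mono split: split_indicator)
  have g_SUP: "(SUP i. g i x) = h' x" for x
  proof (rule antisym)
    show "(SUP i. g i x) \<le> h' x"
      unfolding t(4)[symmetric] by (intro SUP_mono') (simp add: g_def split: split_indicator)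
    obtain n where n: "norm x \<le> real n" using real_arch_simple by blast
    show "h' x \<le> (SUP i. g i x)"
      unfolding t(4)[symmetric]
    proof (rule SUP_least)
      fix i
      have "t i x \<le> t (max i n) x" by (rule t_mono) simp
      also have "\<dots> = g (max i n) x" using n by (auto simp: g_def indicator_def)
      finally show "t i x \<le> (SUP i. g i x)" by (rule SUP_upper2[rotated]) simp
    qed
  qed
  have main: "(\<integral>\<^sup>+\<omega>. (SUP K. \<Prod>k<K. 1 + g i (\<xi> \<omega> k)) \<partial>M) = ennexp (\<integral>\<^sup>+x. g i x \<partial>lborel)" for i
  proof -
    define s where "s x = enn2real (g i x)" for x
    have g_s: "g i x = ennreal (s x)" for x
      using t(3)[of i x] by (auto simp: s_def g_def ennreal_enn2real_if indicator_def)
    have fin: "finite (range s)"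
    proof (rule finite_subset)
      show "range s \<subseteq> enn2real ` (range (t i) \<union> {0})"
        by (auto simp: s_def g_def indicator_def)
      show "finite (enn2real ` (range (t i) \<union> {0}))"
        using simple_functionD(1)[OF t(1)[of i]] by simp
    qed
    have t_le: "t i x \<le> h' x" for x unfolding t(4)[symmetric] by (rule SUP_upper) simp
    have "t i x = 0" if "x \<notin> quadrant" for x using t_le[of x] that by (simp add: h'_def)
    then have "s x = 0" if "x \<notin> quadrant" for x using that by (simp add: s_def g_def)
    moreover have "s x = 0" if "x \<notin> cball 0 (real i)" for x using that by (simp add: s_def g_def)
    ultimately have supp: "{x. s x \<noteq> 0} \<subseteq> quadrant" "{x. s x \<noteq> 0} \<subseteq> cball 0 (real i)"
      by blast+
    have [measurable]: "s \<in> borel_measurable borel" unfolding s_def g_def by measurable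
    have "emeasure lborel {x. s x \<noteq> 0} \<le> emeasure lborel (cball (0::real \<times> real) (real i))"
      by (intro emeasure_mono supp) auto
    also have "\<dots> < \<infinity>" by (rule emeasure_bounded_finite) simp
    finally have supp_finite: "emeasure lborel {x. s x \<noteq> 0} < \<infinity>" .
    show ?thesis
      unfolding g_s
      by (intro nn_integral_pp_prod_simple[OF assms(1) pp _ fin _ supp(1) supp_finite]) (measurable, simp add: s_def)
  qed
  note [measurable] = poisson_pp_component[OF pp]
  have [measurable]: "g i \<in> borel_measurable borel" for i unfolding g_def by measurable
  have "(\<integral>\<^sup>+\<omega>. (SUP K. \<Prod>k<K. 1 + h (\<xi> \<omega> k)) \<partial>M) = (\<integral>\<^sup>+\<omega>. (SUP K. \<Prod>k<K. 1 + h' (\<xi> \<omega> k)) \<partial>M)"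
    by (rule nn_integral_cong_AE) (use poisson_pp_quadrant[OF pp] in \<open>eventually_elim, simp add: h'_def\<close>)
  also have "\<dots> = (\<integral>\<^sup>+\<omega>. (SUP i. SUP K. \<Prod>k<K. 1 + g i (\<xi> \<omega> k)) \<partial>M)"
  proof (intro nn_integral_cong)
    fix \<omega>
    have "(\<Prod>k<K. 1 + h' (\<xi> \<omega> k)) = (SUP i. \<Prod>k<K. 1 + g i (\<xi> \<omega> k))" for K
      unfolding g_SUP[symmetric] by (rule prod_one_plus_SUP[OF g_inc]) simp
    then have "(SUP K. \<Prod>k<K. 1 + h' (\<xi> \<omega> k)) = (SUP K. SUP i. \<Prod>k<K. 1 + g i (\<xi> \<omega> k))"
      by simp
    also have "\<dots> = (SUP i. SUP K. \<Prod>k<K. 1 + g i (\<xi> \<omega> k))"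
      by (rule SUP_commute)
    finally show "(SUP K. \<Prod>k<K. 1 + h' (\<xi> \<omega> k)) = (SUP i. SUP K. \<Prod>k<K. 1 + g i (\<xi> \<omega> k))" .
  qed
  also have "\<dots> = (SUP i. \<integral>\<^sup>+\<omega>. (SUP K. \<Prod>k<K. 1 + g i (\<xi> \<omega> k)) \<partial>M)"
  proof (rule nn_integral_monotone_convergence_SUP)
    show "incseq (\<lambda>i \<omega>. SUP K. \<Prod>k<K. 1 + g i (\<xi> \<omega> k))"
      unfolding incseq_def le_fun_def using g_inc[THEN incseqD]
      by (intro allI impI SUP_mono' prod_one_plus_mono) auto
  qed measurable
  also have "\<dots> = ennexp (SUP i. \<integral>\<^sup>+x. g i x \<partial>lborel)"
    unfolding main using g_inc
    by (intro ennexp_SUP[symmetric]) (auto simp: incseq_def intro!: nn_integral_mono)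
  also have "(SUP i. \<integral>\<^sup>+x. g i x \<partial>lborel) = (\<integral>\<^sup>+x. (SUP i. g i x) \<partial>lborel)"
    using g_inc by (intro nn_integral_monotone_convergence_SUP[symmetric]) (auto simp: incseq_def le_fun_def)
  finally show ?thesis by (simp add: g_SUP h'_def)
qed


text \<open>Second-order expansion in \<open>t\<close> of \<open>\<Prod>(1 + t x\<^sub>k)\<close>: letting \<open>t \<rightarrow> 0\<close> in the exponential
  formula yields the first two moments of \<open>\<Sum>x\<^sub>k\<close>.\<close>

lemma prod_one_plus_expansion:
  fixes x :: "nat \<Rightarrow> real" and t :: real
  assumes x: "\<And>k. 0 \<le> x k" and t: "0 \<le> t" "t \<le> 1"
  defines "S \<equiv> \<lambda>K. \<Sum>k<K. x k" and "Q \<equiv> \<lambda>K. \<Sum>k<K. (x k)\<^sup>2"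
    and "P \<equiv> \<lambda>t K. \<Prod>k<K. 1 + t * x k"
  shows "1 + t * S K \<le> P t K" "P t K \<le> 1 + t * S K + t\<^sup>2 * P 1 K"
    "2 + 2 * t * S K + t\<^sup>2 * (S K)\<^sup>2 \<le> 2 * P t K + t\<^sup>2 * Q K"
    "2 * P t K + t\<^sup>2 * Q K \<le> 2 + 2 * t * S K + t\<^sup>2 * (S K)\<^sup>2 + 2 * t^3 * P 1 K"
proof -
  \<comment> \<open>The first two bounds are carried along for the induction. In the last two,
    \<open>(S K)\<^sup>2 - Q K\<close> is twice the second elementary symmetric polynomial;
    \<open>Q K\<close> is moved to the other side so that the inequalities can be transferred to
    \<open>ennreal\<close>.\<close>
  have "P t K \<le> P 1 K \<and> P t K \<le> 1 + t * P 1 K \<and> 1 + t * S K \<le> P t K \<and>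
    P t K \<le> 1 + t * S K + t\<^sup>2 * P 1 K \<and>
    2 + 2 * t * S K + t\<^sup>2 * (S K)\<^sup>2 \<le> 2 * P t K + t\<^sup>2 * Q K \<and>
    2 * P t K + t\<^sup>2 * Q K \<le> 2 + 2 * t * S K + t\<^sup>2 * (S K)\<^sup>2 + 2 * t^3 * P 1 K"
  proof (induction K)
    case 0
    show ?case using t by (simp add: P_def S_def Q_def)
  next
    case (Suc K)
    define y where "y = x K"
    have y: "0 \<le> y" using x by (simp add: y_def)
    have P: "P u (Suc K) = P u K + u * y * P u K" for u
      by (simp add: P_def y_def algebra_simps)
    have S: "S (Suc K) = S K + y" and Q: "Q (Suc K) = Q K + y\<^sup>2"
      by (simp_all add: S_def Q_def y_def)
    have ty: "0 \<le> t * y" "t * y \<le> y" using t y by (auto simp: mult_left_le_one_le)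
    have P0: "0 \<le> P t K" using t x by (auto simp: P_def intro!: prod_nonneg)
    have P1: "P t K \<le> P 1 K" and P2: "P t K \<le> 1 + t * P 1 K" and P3: "1 + t * S K \<le> P t K"
      and P4: "P t K \<le> 1 + t * S K + t\<^sup>2 * P 1 K"
      using Suc.IH by auto
    have "t * y * P t K \<le> y * P 1 K"
      using ty y P0 P1 by (intro mult_mono) auto
    then have 1: "P t (Suc K) \<le> P 1 (Suc K)" using P1 by (simp add: P)
    have "t * y * P t K \<le> t * y * P 1 K" using ty P1 by (intro mult_left_mono)
    then have 2: "P t (Suc K) \<le> 1 + t * P 1 (Suc K)" using P2 by (simp add: P algebra_simps)
    have "1 + t * S K \<le> P t K \<Longrightarrow> 0 \<le> S K \<Longrightarrow> 1 \<le> P t K"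
      using mult_nonneg_nonneg[OF t(1), of "S K"] by linarith
    then have "1 \<le> P t K" using P3 x by (auto simp: S_def intro!: sum_nonneg)
    then have "t * y * 1 \<le> t * y * P t K" using ty by (intro mult_left_mono)
    then have 3: "1 + t * S (Suc K) \<le> P t (Suc K)" using P3 by (simp add: P S algebra_simps)
    have "t * y * P t K \<le> t * y * (1 + t * P 1 K)" using ty P2 by (intro mult_left_mono)
    then have 4: "P t (Suc K) \<le> 1 + t * S (Suc K) + t\<^sup>2 * P 1 (Suc K)"
      using P4 by (simp add: P S algebra_simps power2_eq_square)
    have "t * y * (1 + t * S K) \<le> t * y * P t K" using ty P3 by (intro mult_left_mono)
    then have 5: "2 + 2 * t * S (Suc K) + t\<^sup>2 * (S (Suc K))\<^sup>2 \<le> 2 * P t (Suc K) + t\<^sup>2 * Q (Suc K)"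
      using Suc.IH by (simp add: P S Q algebra_simps power2_eq_square)
    have "t * y * P t K \<le> t * y * (1 + t * S K + t\<^sup>2 * P 1 K)" using ty P4 by (intro mult_left_mono)
    then have 6: "2 * P t (Suc K) + t\<^sup>2 * Q (Suc K) \<le> 2 + 2 * t * S (Suc K) + t\<^sup>2 * (S (Suc K))\<^sup>2 + 2 * t^3 * P 1 (Suc K)"
      using Suc.IH by (simp add: P S Q algebra_simps power2_eq_square power3_eq_cube)
    show ?case using 1 2 3 4 5 6 by blast
  qed
  then show "1 + t * S K \<le> P t K" "P t K \<le> 1 + t * S K + t\<^sup>2 * P 1 K"
    "2 + 2 * t * S K + t\<^sup>2 * (S K)\<^sup>2 \<le> 2 * P t K + t\<^sup>2 * Q K"
    "2 * P t K + t\<^sup>2 * Q K \<le> 2 + 2 * t * S K + t\<^sup>2 * (S K)\<^sup>2 + 2 * t^3 * P 1 K"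
    by blast+
qed

text \<open>The limit \<open>K \<rightarrow> \<infinity>\<close> of the finite expansions. Since
  nothing is subtracted, it remains valid when the series diverge.\<close>

lemma ennreal_prod_one_plus_expansion:
  fixes x :: "nat \<Rightarrow> real" and t :: real
  assumes x: "\<And>k. 0 \<le> x k" and t: "0 \<le> t" "t \<le> 1"
  defines "S \<equiv> (\<Sum>k. ennreal (x k))" and "Q \<equiv> (\<Sum>k. ennreal ((x k)\<^sup>2))"
    and "P \<equiv> \<lambda>t. SUP K. \<Prod>k<K. 1 + ennreal (t * x k)"
  shows "1 + ennreal t * S \<le> P t" "P t \<le> 1 + ennreal t * S + ennreal (t\<^sup>2) * P 1"
    "2 + ennreal (2 * t) * S + ennreal (t\<^sup>2) * S\<^sup>2 \<le> 2 * P t + ennreal (t\<^sup>2) * Q"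
    "2 * P t + ennreal (t\<^sup>2) * Q \<le> 2 + ennreal (2 * t) * S + ennreal (t\<^sup>2) * S\<^sup>2 + ennreal (2 * t^3) * P 1"
proof -
  let ?S = "\<lambda>K. \<Sum>k<K. x k" and ?Q = "\<lambda>K. \<Sum>k<K. (x k)\<^sup>2" and ?P = "\<lambda>t K. \<Prod>k<K. 1 + t * x k"
  have nonneg: "0 \<le> ?S K" "0 \<le> ?Q K" "0 \<le> u \<Longrightarrow> 0 \<le> ?P u K" for K u
    using x by (auto intro!: sum_nonneg prod_nonneg)
  have S: "(\<lambda>K. ennreal (?S K)) \<longlonglongrightarrow> S" and Q: "(\<lambda>K. ennreal (?Q K)) \<longlonglongrightarrow> Q"
    unfolding S_def Q_def using x by (simp_all add: sum_ennreal[symmetric] summable_LIMSEQ del: sum_ennreal)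
  have P: "(\<lambda>K. ennreal (?P u K)) \<longlonglongrightarrow> P u" if "0 \<le> u" for u
  proof -
    have "ennreal (?P u K) = (\<Prod>k<K. 1 + ennreal (u * x k))" for K
      using that x by (subst prod_ennreal[symmetric]) auto
    then show ?thesis unfolding P_def by (simp add: LIMSEQ_SUP incseq_prod_one_plus)
  qed
  have S2: "(\<lambda>K. ennreal (?S K) ^ 2) \<longlonglongrightarrow> S\<^sup>2"
    unfolding power2_eq_square by (intro tendsto_mult_ennreal S) auto
  have e1: "ennreal (1 + t * a) = 1 + ennreal t * ennreal a"
    and e2: "ennreal (1 + t * a + t\<^sup>2 * p) = 1 + ennreal t * ennreal a + ennreal (t\<^sup>2) * ennreal p"
    and e3: "ennreal (2 + 2 * t * a + t\<^sup>2 * a\<^sup>2) = 2 + ennreal (2 * t) * ennreal a + ennreal (t\<^sup>2) * (ennreal a)\<^sup>2"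
    and e4: "ennreal (2 * p + t\<^sup>2 * a) = 2 * ennreal p + ennreal (t\<^sup>2) * ennreal a"
    and e5: "ennreal (2 + 2 * t * a + t\<^sup>2 * a\<^sup>2 + 2 * t^3 * p) = 2 + ennreal (2 * t) * ennreal a + ennreal (t\<^sup>2) * (ennreal a)\<^sup>2 + ennreal (2 * t^3) * ennreal p"
    if "0 \<le> a" "0 \<le> p" for a p
    using that t
    by (simp_all add: ennreal_power flip: ennreal_plus ennreal_mult ennreal_1 ennreal_numeral)
  have l1: "(\<lambda>K. ennreal (1 + t * ?S K)) \<longlonglongrightarrow> 1 + ennreal t * S"
    unfolding e1[OF nonneg(1) nonneg(1)]
    by (intro tendsto_add tendsto_const S ennreal_tendsto_cmult ennreal_less_top)
  have l2: "(\<lambda>K. ennreal (1 + t * ?S K + t\<^sup>2 * ?P 1 K)) \<longlonglongrightarrow> 1 + ennreal t * S + ennreal (t\<^sup>2) * P 1"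
    unfolding e2[OF nonneg(1) nonneg(3)[OF zero_le_one]]
    by (intro tendsto_add tendsto_const S P zero_le_one ennreal_tendsto_cmult ennreal_less_top)
  have l3: "(\<lambda>K. ennreal (2 + 2 * t * ?S K + t\<^sup>2 * (?S K)\<^sup>2)) \<longlonglongrightarrow> 2 + ennreal (2 * t) * S + ennreal (t\<^sup>2) * S\<^sup>2"
    unfolding e3[OF nonneg(1) nonneg(1)]
    by (intro tendsto_add tendsto_const S S2 ennreal_tendsto_cmult ennreal_less_top)
  have l4: "(\<lambda>K. ennreal (2 * ?P t K + t\<^sup>2 * ?Q K)) \<longlonglongrightarrow> 2 * P t + ennreal (t\<^sup>2) * Q"
    unfolding e4[OF nonneg(2) nonneg(3)[OF t(1)]]
    by (intro tendsto_add P t Q ennreal_tendsto_cmult ennreal_less_top) simp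
  have l5: "(\<lambda>K. ennreal (2 + 2 * t * ?S K + t\<^sup>2 * (?S K)\<^sup>2 + 2 * t^3 * ?P 1 K)) \<longlonglongrightarrow>
      2 + ennreal (2 * t) * S + ennreal (t\<^sup>2) * S\<^sup>2 + ennreal (2 * t^3) * P 1"
    unfolding e5[OF nonneg(1) nonneg(3)[OF zero_le_one]]
    by (intro tendsto_add tendsto_const S S2 P zero_le_one ennreal_tendsto_cmult ennreal_less_top)
  note le = prod_one_plus_expansion[OF x t, THEN ennreal_leI]
  show "1 + ennreal t * S \<le> P t"
    by (rule LIMSEQ_le[OF l1 P[OF t(1)]]) (intro exI allI impI le(1))
  show "P t \<le> 1 + ennreal t * S + ennreal (t\<^sup>2) * P 1"
    by (rule LIMSEQ_le[OF P[OF t(1)] l2]) (intro exI allI impI le(2))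
  show "2 + ennreal (2 * t) * S + ennreal (t\<^sup>2) * S\<^sup>2 \<le> 2 * P t + ennreal (t\<^sup>2) * Q"
    by (rule LIMSEQ_le[OF l3 l4]) (intro exI allI impI le(3))
  show "2 * P t + ennreal (t\<^sup>2) * Q \<le> 2 + ennreal (2 * t) * S + ennreal (t\<^sup>2) * S\<^sup>2 + ennreal (2 * t^3) * P 1"
    by (rule LIMSEQ_le[OF l4 l5]) (intro exI allI impI le(4))
qed


section \<open>First and second moments of Poisson sums (Campbell's formulas)\<close>

lemma le_if_le_add_mult:
  fixes a b c d :: real
  assumes "0 < d" "\<And>t. 0 < t \<Longrightarrow> t \<le> d \<Longrightarrow> a \<le> b + t * c"
  shows "a \<le> b"
proof (rule tendsto_lowerbound)
  have "((\<lambda>t. b + t * c) \<longlongrightarrow> b + 0 * c) (at_right 0)" by (intro tendsto_intros)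
  then show "((\<lambda>t. b + t * c) \<longlongrightarrow> b) (at_right 0)" by simp
  show "eventually (\<lambda>t. a \<le> b + t * c) (at_right 0)"
    using assms unfolding eventually_at_right_field by (intro exI[of _ d]) auto
qed simp

text \<open>The exact second-order coefficient with a crude cubic remainder: after division by
  \<open>t\<^sup>2\<close> the remainder vanishes as \<open>t \<rightarrow> 0\<close>.\<close>

lemma exp_le_cubic:
  fixes t :: real
  assumes "0 \<le> t" "t \<le> 1"
  shows "exp t \<le> 1 + t + t\<^sup>2 / 2 + t^3"
proof -
  let ?f = "\<lambda>t::real. 1 + t + t\<^sup>2 / 2 + t^3 - exp t"
  have "?f 0 \<le> ?f t"
  proof (rule DERIV_nonneg_imp_nondecreasing[OF assms(1)])
    fix x assume x: "0 \<le> x" "x \<le> t"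
    have "(?f has_real_derivative 1 + x + 3 * x\<^sup>2 - exp x) (at x)"
      by (auto intro!: derivative_eq_intros simp: power2_eq_square)
    moreover have "exp x \<le> 1 + x + 3 * x\<^sup>2"
    proof -
      have "exp x \<le> 1 + x + x\<^sup>2" using x assms by (intro exp_bound) auto
      also have "\<dots> \<le> 1 + x + 3 * x\<^sup>2" by simp
      finally show ?thesis .
    qed
    ultimately show "\<exists>y. (?f has_real_derivative y) (at x) \<and> 0 \<le> y"
      by (intro exI[of _ "1 + x + 3 * x\<^sup>2 - exp x"] conjI) auto
  qed
  then show ?thesis by simp
qed

lemma nn_integral_pp_prod_scaled:
  assumes "prob_space M" and pp: "poisson_pp_lebesgue M \<xi>"
    and [measurable]: "h \<in> borel_measurable borel" and nonneg: "\<And>z. 0 \<le> h z"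
    and m: "(\<integral>\<^sup>+z. ennreal (h z) * indicator quadrant z \<partial>lborel) = ennreal m" "0 \<le> m"
    and t: "0 \<le> t"
  shows "(\<integral>\<^sup>+\<omega>. (SUP K. \<Prod>k<K. 1 + ennreal (t * h (\<xi> \<omega> k))) \<partial>M) = ennreal (exp (t * m))"
proof -
  have "(\<integral>\<^sup>+z. ennreal (t * h z) * indicator quadrant z \<partial>lborel) = (\<integral>\<^sup>+z. ennreal t * (ennreal (h z) * indicator quadrant z) \<partial>lborel)"
    using t nonneg by (simp add: ennreal_mult mult.assoc)
  also have "\<dots> = ennreal (t * m)"
    using t m by (simp add: nn_integral_cmult ennreal_mult)
  finally show ?thesis
    using t m by (subst nn_integral_pp_prod[OF assms(1) pp]) (simp_all add: ennexp_ennreal)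
qed

text \<open>The mean of the products is \<open>exp (t * m)\<close>. Comparing it with both
  first-order bounds, dividing by \<open>t\<close> and letting \<open>t \<rightarrow> 0\<close>
  gives the two inequalities.\<close>

lemma nn_integral_pp_sum:
  assumes "prob_space M" and pp: "poisson_pp_lebesgue M \<xi>"
    and [measurable]: "h \<in> borel_measurable borel" and nonneg: "\<And>z. 0 \<le> h z"
    and m: "(\<integral>\<^sup>+z. ennreal (h z) * indicator quadrant z \<partial>lborel) = ennreal m" "0 \<le> m"
  shows "(\<integral>\<^sup>+\<omega>. (\<Sum>k. ennreal (h (\<xi> \<omega> k))) \<partial>M) = ennreal m"
proof -
  interpret prob_space M by fact
  note [measurable] = poisson_pp_component[OF pp]
  note E = nn_integral_pp_prod_scaled[OF assms]
  let ?S = "\<lambda>\<omega>. \<Sum>k. ennreal (h (\<xi> \<omega> k))"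
  let ?P = "\<lambda>t \<omega>. SUP K. \<Prod>k<K. 1 + ennreal (t * h (\<xi> \<omega> k))"
  have le1: "1 + ennreal t * integral\<^sup>N M ?S \<le> ennreal (exp (t * m))" if t: "0 \<le> t" "t \<le> 1" for t
  proof -
    have "1 + ennreal t * integral\<^sup>N M ?S = (\<integral>\<^sup>+\<omega>. 1 + ennreal t * ?S \<omega> \<partial>M)"
      by (simp add: nn_integral_add nn_integral_cmult emeasure_space_1)
    also have "\<dots> \<le> integral\<^sup>N M (?P t)"
      using ennreal_prod_one_plus_expansion(1)[OF nonneg t] by (intro nn_integral_mono)
    finally show ?thesis using E[OF t(1)] by simp
  qed
  \<comment> \<open>The case \<open>t = 1\<close> shows that the mean is finite; the comparison can
    then be carried out in the reals.\<close>
  have "integral\<^sup>N M ?S \<le> 1 + ennreal 1 * integral\<^sup>N M ?S" by (simp add: add_increasing)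
  also have "\<dots> \<le> ennreal (exp (1 * m))" by (rule le1) auto
  also have "\<dots> < \<top>" by simp
  finally obtain x where x: "integral\<^sup>N M ?S = ennreal x" "0 \<le> x" by (cases "integral\<^sup>N M ?S") auto
  have "x \<le> m"
  proof (rule le_if_le_add_mult)
    \<comment> \<open>This range of \<open>t\<close> keeps \<open>t * m \<le> 1\<close>, as the
      Taylor bound on \<open>exp\<close> requires.\<close>
    show "0 < min 1 (1 / (m + 1))" using m by simp
    fix t assume t: "0 < t" "t \<le> min 1 (1 / (m + 1))"
    have tm: "t * m \<le> 1"
    proof -
      have "t * m \<le> t * (m + 1)" using t by (intro mult_left_mono) auto
      also have "\<dots> \<le> 1" using t m by (simp add: field_simps)
      finally show ?thesis .
    qed
    have "1 + t * x \<le> exp (t * m)"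
      using le1[of t] t x by (simp flip: ennreal_1 ennreal_plus ennreal_mult)
    also have "\<dots> \<le> 1 + t * m + (t * m)\<^sup>2" using tm t m by (intro exp_bound) auto
    finally have "t * x \<le> t * (m + t * m\<^sup>2)" by (simp add: power2_eq_square algebra_simps)
    then show "x \<le> m + t * m\<^sup>2" using t by simp
  qed
  moreover have "m \<le> x"
  proof (rule le_if_le_add_mult)
    fix t :: real assume t: "0 < t" "t \<le> 1"
    have "ennreal (exp (t * m)) = integral\<^sup>N M (?P t)" using E[of t] t by simp
    also have "\<dots> \<le> (\<integral>\<^sup>+\<omega>. 1 + ennreal t * ?S \<omega> + ennreal (t\<^sup>2) * ?P 1 \<omega> \<partial>M)"
      using ennreal_prod_one_plus_expansion(2)[OF nonneg, of t] t by (intro nn_integral_mono) simp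
    also have "\<dots> = 1 + ennreal t * integral\<^sup>N M ?S + ennreal (t\<^sup>2) * integral\<^sup>N M (?P 1)"
      by (simp add: nn_integral_add nn_integral_cmult emeasure_space_1 del: mult_1)
    also have "\<dots> = ennreal (1 + t * x + t\<^sup>2 * exp m)"
      using x t E[of 1] by (simp add: ennreal_mult)
    finally have "exp (t * m) \<le> 1 + t * x + t\<^sup>2 * exp m"
      using x t by (subst (asm) ennreal_le_iff) (auto intro!: add_nonneg_nonneg)
    from order_trans[OF exp_ge_add_one_self this] have "t * m \<le> t * (x + t * exp m)" by (simp add: power2_eq_square algebra_simps)
    then show "m \<le> x + t * exp m" using t by simp
  qed simp
  ultimately show ?thesis using x by simp
qed

text \<open>The same comparison one order higher: the terms \<open>2 + 2 * t * m\<close> cancel, and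
  dividing by \<open>t\<^sup>2\<close> leaves \<open>m\<^sup>2 + q\<close>. Thus \<open>q\<close> is
  the variance of the sum.\<close>

lemma nn_integral_pp_sum_square:
  assumes "prob_space M" and pp: "poisson_pp_lebesgue M \<xi>"
    and [measurable]: "h \<in> borel_measurable borel" and nonneg: "\<And>z. 0 \<le> h z"
    and m: "(\<integral>\<^sup>+z. ennreal (h z) * indicator quadrant z \<partial>lborel) = ennreal m" "0 \<le> m"
    and q: "(\<integral>\<^sup>+z. ennreal ((h z)\<^sup>2) * indicator quadrant z \<partial>lborel) = ennreal q" "0 \<le> q"
  shows "(\<integral>\<^sup>+\<omega>. (\<Sum>k. ennreal (h (\<xi> \<omega> k)))\<^sup>2 \<partial>M) = ennreal (m\<^sup>2 + q)"
proof -
  interpret prob_space M by fact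
  note [measurable] = poisson_pp_component[OF pp]
  note E = nn_integral_pp_prod_scaled[OF assms(1-6)]
  let ?S = "\<lambda>\<omega>. \<Sum>k. ennreal (h (\<xi> \<omega> k))"
  let ?Q = "\<lambda>\<omega>. \<Sum>k. ennreal ((h (\<xi> \<omega> k))\<^sup>2)"
  let ?P = "\<lambda>t \<omega>. SUP K. \<Prod>k<K. 1 + ennreal (t * h (\<xi> \<omega> k))"
  have S: "integral\<^sup>N M ?S = ennreal m" by (rule nn_integral_pp_sum[OF assms(1-6)])
  have Q: "integral\<^sup>N M ?Q = ennreal q"
    by (rule nn_integral_pp_sum[OF assms(1,2) _ _ q]) auto
  define y where "y = (\<integral>\<^sup>+\<omega>. (?S \<omega>)\<^sup>2 \<partial>M)"
  have le1: "2 + ennreal (2 * t * m) + ennreal (t\<^sup>2) * y \<le> ennreal (2 * exp (t * m) + t\<^sup>2 * q)" if t: "0 \<le> t" "t \<le> 1" for t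
  proof -
    have "2 + ennreal (2 * t * m) + ennreal (t\<^sup>2) * y = 2 + ennreal (2 * t) * integral\<^sup>N M ?S + ennreal (t\<^sup>2) * y"
      unfolding S using t m by (simp add: ennreal_mult)
    also have "\<dots> = (\<integral>\<^sup>+\<omega>. 2 + ennreal (2 * t) * ?S \<omega> + ennreal (t\<^sup>2) * (?S \<omega>)\<^sup>2 \<partial>M)"
      unfolding y_def by (simp add: nn_integral_add nn_integral_cmult emeasure_space_1)
    also have "\<dots> \<le> (\<integral>\<^sup>+\<omega>. 2 * ?P t \<omega> + ennreal (t\<^sup>2) * ?Q \<omega> \<partial>M)"
      using ennreal_prod_one_plus_expansion(3)[OF nonneg t] by (intro nn_integral_mono)
    also have "\<dots> = 2 * ennreal (exp (t * m)) + ennreal (t\<^sup>2) * ennreal q"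
      using E[OF t(1)] Q by (simp add: nn_integral_add nn_integral_cmult)
    also have "\<dots> = ennreal (2 * exp (t * m) + t\<^sup>2 * q)"
      using q by (simp flip: ennreal_plus ennreal_mult ennreal_numeral)
    finally show ?thesis .
  qed
  have "y \<le> 2 + ennreal (2 * 1 * m) + ennreal (1\<^sup>2) * y" by (simp add: add_increasing)
  also have "\<dots> \<le> ennreal (2 * exp (1 * m) + 1\<^sup>2 * q)" by (rule le1) auto
  also have "\<dots> < \<top>" by simp
  finally obtain x where x: "y = ennreal x" "0 \<le> x" by (cases y) auto
  have "x \<le> m\<^sup>2 + q"
  proof (rule le_if_le_add_mult)
    show "0 < min 1 (1 / (m + 1))" using m by simp
    fix t assume t: "0 < t" "t \<le> min 1 (1 / (m + 1))"
    have tm: "t * m \<le> 1"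
    proof -
      have "t * m \<le> t * (m + 1)" using t by (intro mult_left_mono) auto
      also have "\<dots> \<le> 1" using t m by (simp add: field_simps)
      finally show ?thesis .
    qed
    have "ennreal (2 + 2 * t * m + t\<^sup>2 * x) = 2 + ennreal (2 * t * m) + ennreal (t\<^sup>2) * y"
      using x t m by (simp flip: ennreal_plus ennreal_mult ennreal_numeral)
    also have "\<dots> \<le> ennreal (2 * exp (t * m) + t\<^sup>2 * q)" using t by (intro le1) auto
    finally have 1: "2 + 2 * t * m + t\<^sup>2 * x \<le> 2 * exp (t * m) + t\<^sup>2 * q"
      using q by (subst (asm) ennreal_le_iff) (auto intro!: add_nonneg_nonneg)
    have 2: "exp (t * m) \<le> 1 + t * m + (t * m)\<^sup>2 / 2 + (t * m) ^ 3"
      using tm t m by (intro exp_le_cubic) auto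
    have "d \<le> b + 2 * c + f"
      if "2 + 2 * t * m + d \<le> 2 * e + f" "e \<le> 1 + t * m + b / 2 + c" for b c d e f :: real
      using that by linarith
    from this[OF 1 2] have "t\<^sup>2 * x \<le> (t * m)\<^sup>2 + 2 * (t * m) ^ 3 + t\<^sup>2 * q" .
    also have "\<dots> = t\<^sup>2 * (m\<^sup>2 + q + t * (2 * m ^ 3))"
      by (simp add: power2_eq_square power3_eq_cube algebra_simps)
    finally show "x \<le> m\<^sup>2 + q + t * (2 * m ^ 3)" using t by simp
  qed
  moreover have "m\<^sup>2 + q \<le> x"
  proof (rule le_if_le_add_mult)
    fix t :: real assume t: "0 < t" "t \<le> 1"
    have t0: "0 \<le> t" using t by simp
    have "ennreal (2 * exp (t * m) + t\<^sup>2 * q) = 2 * ennreal (exp (t * m)) + ennreal (t\<^sup>2) * ennreal q"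
      using q by (simp flip: ennreal_plus ennreal_mult ennreal_numeral)
    also have "\<dots> = (\<integral>\<^sup>+\<omega>. 2 * ?P t \<omega> + ennreal (t\<^sup>2) * ?Q \<omega> \<partial>M)"
      using E[OF t0] Q by (simp add: nn_integral_add nn_integral_cmult)
    also have "\<dots> \<le> (\<integral>\<^sup>+\<omega>. 2 + ennreal (2 * t) * ?S \<omega> + ennreal (t\<^sup>2) * (?S \<omega>)\<^sup>2 + ennreal (2 * t^3) * ?P 1 \<omega> \<partial>M)"
      using ennreal_prod_one_plus_expansion(4)[OF nonneg t0 t(2)] by (intro nn_integral_mono)
    also have "\<dots> = 2 + ennreal (2 * t) * integral\<^sup>N M ?S + ennreal (t\<^sup>2) * y + ennreal (2 * t^3) * integral\<^sup>N M (?P 1)"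
      unfolding y_def by (simp add: nn_integral_add nn_integral_cmult emeasure_space_1 del: mult_1)
    also have "\<dots> = ennreal (2 + 2 * t * m + t\<^sup>2 * x + 2 * t^3 * exp m)"
      unfolding S E[OF zero_le_one] using x t m
      by (simp flip: ennreal_plus ennreal_mult ennreal_numeral)
    finally have 1: "2 * exp (t * m) + t\<^sup>2 * q \<le> 2 + 2 * t * m + t\<^sup>2 * x + 2 * t^3 * exp m"
      using x t m by (subst (asm) ennreal_le_iff) (auto intro!: add_nonneg_nonneg)
    have 2: "1 + t * m + (t * m)\<^sup>2 / 2 \<le> exp (t * m)"
      using t m by (intro exp_lower_Taylor_quadratic) auto
    have "b + f \<le> d + c"
      if "2 * e + f \<le> 2 + 2 * t * m + d + c" "1 + t * m + b / 2 \<le> e" for b c d e f :: real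
      using that by linarith
    from this[OF 1 2] have "(t * m)\<^sup>2 + t\<^sup>2 * q \<le> t\<^sup>2 * x + 2 * t^3 * exp m" .
    moreover have "t\<^sup>2 * (m\<^sup>2 + q) = (t * m)\<^sup>2 + t\<^sup>2 * q"
      by (simp add: power2_eq_square algebra_simps)
    moreover have "t\<^sup>2 * (x + t * (2 * exp m)) = t\<^sup>2 * x + 2 * t^3 * exp m"
      by (simp add: power2_eq_square power3_eq_cube algebra_simps)
    ultimately have "t\<^sup>2 * (m\<^sup>2 + q) \<le> t\<^sup>2 * (x + t * (2 * exp m))" by simp
    then show "m\<^sup>2 + q \<le> x + t * (2 * exp m)" using t by simp
  qed simp
  ultimately show ?thesis using x by (simp add: y_def)
qed

section \<open>The branching random walk\<close>

definition weight :: "real \<times> real \<Rightarrow> real" where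
  "weight z = exp (- (fst z + snd z))"

lemma weight_pos: "0 < weight z" "0 \<le> weight z"
  by (simp_all add: weight_def)

lemma weight_add: "weight (x + y) = weight x * weight y"
  by (simp add: weight_def flip: exp_add)

lemma measurable_weight [measurable]: "weight \<in> borel_measurable borel"
  unfolding weight_def[abs_def] by (subst borel_prod[symmetric]) measurable

text \<open>Substituting \<open>z = x + y\<close> leaves for each \<open>z\<close> the segment
  \<open>0 < x < z\<close>, of length \<open>z\<close>; this produces the kernel of
  \<open>cumulant_iter\<close>.\<close>

lemma nn_integral_quadrant_weight:
  assumes [measurable]: "f \<in> borel_measurable borel"
  shows "(\<integral>\<^sup>+p. f (weight p) * indicator quadrant p \<partial>lborel) =
    (\<integral>\<^sup>+z. ennreal z * f (exp (- z)) * indicator {0..} z \<partial>lborel)"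
proof -
  let ?I = "\<lambda>x y. indicator {0<..} x * indicator {0<..} y * f (exp (- (x + y))) :: ennreal"
  have "(\<integral>\<^sup>+p. f (weight p) * indicator quadrant p \<partial>lborel) = (\<integral>\<^sup>+p. (case p of (x, y) \<Rightarrow> ?I x y) \<partial>(lborel \<Otimes>\<^sub>M lborel))"
    unfolding lborel_prod
    by (intro nn_integral_cong) (auto simp: weight_def quadrant_def indicator_def)
  also have "\<dots> = (\<integral>\<^sup>+x. \<integral>\<^sup>+y. ?I x y \<partial>lborel \<partial>lborel)"
    by (subst lborel.nn_integral_fst[symmetric]) auto
  also have "\<dots> = (\<integral>\<^sup>+x. \<integral>\<^sup>+z. indicator {0<..} x * (indicator {0<..} (z - x) * f (exp (- z))) \<partial>lborel \<partial>lborel)"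
  proof (rule nn_integral_cong)
    fix x :: real
    have "(\<integral>\<^sup>+z. indicator {0<..} x * (indicator {0<..} (z - x) * f (exp (- z))) \<partial>lborel) =
      (\<integral>\<^sup>+y. indicator {0<..} x * (indicator {0<..} (x + 1 * y - x) * f (exp (- (x + 1 * y)))) \<partial>lborel)"
      by (subst nn_integral_real_affine[where c = 1 and t = x]) auto
    also have "\<dots> = (\<integral>\<^sup>+y. ?I x y \<partial>lborel)"
      by (intro nn_integral_cong) (auto simp: indicator_def)
    finally show "(\<integral>\<^sup>+y. ?I x y \<partial>lborel) = (\<integral>\<^sup>+z. indicator {0<..} x * (indicator {0<..} (z - x) * f (exp (- z))) \<partial>lborel)" by simp
  qed
  also have "\<dots> = (\<integral>\<^sup>+z. \<integral>\<^sup>+x. indicator {0<..} x * (indicator {0<..} (z - x) * f (exp (- z))) \<partial>lborel \<partial>lborel)"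
    by (rule lborel_pair.Fubini') measurable
  also have "\<dots> = (\<integral>\<^sup>+z. \<integral>\<^sup>+x. f (exp (- z)) * indicator {0<..<z} x \<partial>lborel \<partial>lborel)"
    by (intro nn_integral_cong) (auto simp: indicator_def)
  also have "\<dots> = (\<integral>\<^sup>+z. ennreal z * f (exp (- z)) * indicator {0..} z \<partial>lborel)"
  proof (intro nn_integral_cong)
    fix z :: real
    have "(\<integral>\<^sup>+x. f (exp (- z)) * indicator {0<..<z} x \<partial>lborel) = f (exp (- z)) * emeasure lborel {0<..<z}"
      by (rule nn_integral_cmult_indicator) simp
    also have "\<dots> = ennreal z * f (exp (- z)) * indicator {0..} z"
      by (cases "0 \<le> z") (simp_all add: mult.commute)
    finally show "(\<integral>\<^sup>+x. f (exp (- z)) * indicator {0<..<z} x \<partial>lborel) = ennreal z * f (exp (- z)) * indicator {0..} z" .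
  qed
  finally show ?thesis .
qed

lemma nn_integral_quadrant_weight_power:
  assumes "0 < q"
  shows "(\<integral>\<^sup>+p. ennreal (weight p ^ q) * indicator quadrant p \<partial>lborel) = ennreal (1 / (real q)\<^sup>2)"
proof -
  have "(\<integral>\<^sup>+p. ennreal (weight p ^ q) * indicator quadrant p \<partial>lborel) =
    (\<integral>\<^sup>+z. ennreal z * ennreal (exp (- z) ^ q) * indicator {0..} z \<partial>lborel)"
    by (rule nn_integral_quadrant_weight) measurable
  also have "\<dots> = (\<integral>\<^sup>+z. ennreal (z * (1 * (1 * exp (- z)) ^ q)) * indicator {0..} z \<partial>lborel)"
    by (intro nn_integral_cong) (simp add: ennreal_mult indicator_def)
  also have "\<dots> = ennreal (1 / (real q)\<^sup>2)"
    using assms by (subst nn_integral_times_exp_power) auto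
  finally show ?thesis .
qed

text \<open>The martingale of the subtree rooted at \<open>v\<close>, as a functional of the
  displacement family \<open>c\<close> instead of \<open>\<omega>\<close>. In this form
  \<open>c\<close> can be restricted to the labels of a subtree, which is what the independence
  arguments use.\<close>

definition tree_W :: "nat list \<Rightarrow> nat \<Rightarrow> (nat list \<Rightarrow> nat \<Rightarrow> real \<times> real) \<Rightarrow> ennreal" where
  "tree_W v n c = (\<integral>\<^sup>+u. (if length u = n
     then ennreal (weight (\<Sum>i<n. c (v @ take i u) (u ! i))) else 0) \<partial>count_space UNIV)"

lemma brw_W_n_eq_tree_W: "brw_W_n \<xi> n \<omega> = tree_W [] n (\<lambda>u. \<xi> u \<omega>)"
  unfolding brw_W_n_def tree_W_def brw_pos_def weight_def by (intro nn_integral_cong) auto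

lemma tree_W_0 [simp]: "tree_W v 0 c = 1"
proof -
  have "tree_W v 0 c = (\<integral>\<^sup>+u. indicator {[] :: nat list} u \<partial>count_space UNIV)"
    unfolding tree_W_def by (intro nn_integral_cong) (auto simp: weight_def indicator_def)
  then show ?thesis by simp
qed

text \<open>Splitting a label of length \<open>Suc n\<close> into its first letter \<open>k\<close>
  and the rest decomposes the sum over the children of \<open>v\<close>; \<open>weight\<close> is
  multiplicative along the path.\<close>

lemma tree_W_Suc: "tree_W v (Suc n) c = (\<Sum>k. ennreal (weight (c v k)) * tree_W (v @ [k]) n c)"
proof -
  define g where "g u = (if length u = Suc n
     then ennreal (weight (\<Sum>i<Suc n. c (v @ take i u) (u ! i))) else 0)" for u
  have g_Cons: "g (k # u) = ennreal (weight (c v k)) *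
      (if length u = n then ennreal (weight (\<Sum>i<n. c ((v @ [k]) @ take i u) (u ! i))) else 0)" for k u
  proof -
    have "(\<Sum>i<Suc n. c (v @ take i (k # u)) ((k # u) ! i)) = c v k + (\<Sum>i<n. c ((v @ [k]) @ take i u) (u ! i))"
      by (subst sum.lessThan_Suc_shift) simp
    then show ?thesis
      by (simp add: g_def weight_add ennreal_mult weight_pos del: sum.lessThan_Suc append_assoc)
  qed
  have "tree_W v (Suc n) c = (\<integral>\<^sup>+u. g u \<partial>count_space UNIV)"
    unfolding tree_W_def g_def ..
  also have "\<dots> = (\<integral>\<^sup>+u. g u \<partial>count_space (- {[]}))"
    by (rule nn_integral_count_space_eq) (auto simp: g_def)
  also have "\<dots> = (\<integral>\<^sup>+p. g (case p of (k, u) \<Rightarrow> k # u) \<partial>count_space (UNIV :: (nat \<times> nat list) set))"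
  proof (rule nn_integral_bij_count_space[symmetric])
    show "bij_betw (\<lambda>p. case p of (k, u) \<Rightarrow> k # u) (UNIV :: (nat \<times> nat list) set) (- {[]})"
      by (auto simp: bij_betw_def inj_on_def image_def neq_Nil_conv)
  qed
  also have "\<dots> = (\<integral>\<^sup>+k. \<integral>\<^sup>+u. g (k # u) \<partial>count_space UNIV \<partial>count_space UNIV)"
    by (subst nn_integral_fst_count_space[symmetric]) simp
  also have "\<dots> = (\<Sum>k. \<integral>\<^sup>+u. g (k # u) \<partial>count_space UNIV)"
    by (rule nn_integral_count_space_nat)
  also have "\<dots> = (\<Sum>k. ennreal (weight (c v k)) * tree_W (v @ [k]) n c)"
    by (simp add: g_Cons nn_integral_cmult tree_W_def)
  finally show ?thesis .
qed

lemma measurable_tree_W: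
  assumes "\<And>u. v @ u \<in> K"
  shows "tree_W v n \<in> borel_measurable (\<Pi>\<^sub>M u\<in>K. \<Pi>\<^sub>M k\<in>UNIV. borel)"
  using assms
proof (induction n arbitrary: v)
  case 0
  then show ?case by (simp cong: measurable_cong)
next
  case (Suc n)
  have [measurable]: "tree_W (v @ [k]) n \<in> borel_measurable (\<Pi>\<^sub>M u\<in>K. \<Pi>\<^sub>M k\<in>UNIV. borel)" for k
    using Suc.prems by (intro Suc.IH) simp
  have "v \<in> K" using Suc.prems[of "[]"] by simp
  then have [measurable]: "(\<lambda>c. c v k :: real \<times> real) \<in> borel_measurable (\<Pi>\<^sub>M u\<in>K. \<Pi>\<^sub>M k\<in>UNIV. borel)" for k :: nat
  proof -
    have "(\<lambda>c. c v) \<in> (\<Pi>\<^sub>M u\<in>K. \<Pi>\<^sub>M k\<in>UNIV. (borel :: (real \<times> real) measure)) \<rightarrow>\<^sub>M (\<Pi>\<^sub>M k\<in>UNIV. borel)"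
      using \<open>v \<in> K\<close> by (rule measurable_component_singleton)
    from measurable_compose[OF this measurable_component_singleton[of k UNIV]] show ?thesis
      by simp
  qed
  have "(\<lambda>c. tree_W v (Suc n) c) \<in> borel_measurable (\<Pi>\<^sub>M u\<in>K. \<Pi>\<^sub>M k\<in>UNIV. borel)"
    unfolding tree_W_Suc by measurable
  then show ?case by simp
qed

text \<open>Only coordinates at labels extending \<open>v\<close> enter, so any index set containing
  them determines the value.\<close>

lemma tree_W_restrict: "(\<And>u. v @ u \<in> K) \<Longrightarrow> tree_W v n (restrict c K) = tree_W v n c"
  unfolding tree_W_def by (intro nn_integral_cong) simp

section \<open>Independence along the tree and the law of the martingale\<close>

locale branching = prob_space M for M :: "'a measure" +
  fixes \<xi> :: "nat list \<Rightarrow> 'a \<Rightarrow> nat \<Rightarrow> real \<times> real"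
  assumes poisson: "\<And>u. poisson_pp_lebesgue M (\<xi> u)"
    and indep: "indep_vars (\<lambda>_. \<Pi>\<^sub>M k\<in>UNIV. borel) \<xi> UNIV"
begin

definition W :: "nat list \<Rightarrow> nat \<Rightarrow> 'a \<Rightarrow> ennreal" where
  "W v n \<omega> = tree_W v n (\<lambda>u. \<xi> u \<omega>)"

lemma brw_W_n_eq: "brw_W_n \<xi> n = W [] n"
  by (simp add: fun_eq_iff W_def brw_W_n_eq_tree_W)

lemma W_0: "W v 0 \<omega> = 1"
  by (simp add: W_def)

lemma W_Suc: "W v (Suc n) \<omega> = (\<Sum>k. ennreal (weight (\<xi> v \<omega> k)) * W (v @ [k]) n \<omega>)"
  by (simp add: W_def tree_W_Suc)

lemma measurable_\<xi> [measurable]: "\<xi> u \<in> M \<rightarrow>\<^sub>M (\<Pi>\<^sub>M k\<in>UNIV. borel)"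
  by (rule poisson_pp_measurable[OF poisson])

lemma measurable_W [measurable]: "W v n \<in> borel_measurable M"
proof -
  have "(\<lambda>\<omega>. \<lambda>u\<in>UNIV. \<xi> u \<omega>) \<in> M \<rightarrow>\<^sub>M (\<Pi>\<^sub>M u\<in>UNIV. \<Pi>\<^sub>M k\<in>UNIV. borel)"
    by (intro measurable_restrict measurable_\<xi>)
  from measurable_compose[OF this measurable_tree_W[of v UNIV n]]
  show ?thesis by (simp add: W_def[abs_def] restrict_def)
qed

text \<open>The subtrees of different children read disjoint sets of labels. The generation
  \<open>n k\<close> may depend on the child, for the mixed products in the second moment
  computation.\<close>

lemma indep_subtrees:
  assumes [measurable]: "\<And>k. f k \<in> borel_measurable borel"
  shows "indep_vars (\<lambda>_. borel) (\<lambda>k \<omega>. f k (W (v @ [k]) (n k) \<omega>)) I"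
proof -
  define K where "K k = range (\<lambda>u. v @ k # u)" for k
  have "indep_vars (\<lambda>j. Pi\<^sub>M (K j) (\<lambda>_. \<Pi>\<^sub>M k\<in>UNIV. borel)) (\<lambda>j \<omega>. restrict (\<lambda>i. \<xi> i \<omega>) (K j)) I"
    by (rule indep_vars_restrict[OF indep]) (auto simp: K_def disjoint_family_on_def)
  then have "indep_vars (\<lambda>_. borel) (\<lambda>k \<omega>. f k (tree_W (v @ [k]) (n k) (restrict (\<lambda>i. \<xi> i \<omega>) (K k)))) I"
  proof (rule indep_vars_compose2)
    fix k
    have [measurable]: "tree_W (v @ [k]) (n k) \<in> borel_measurable (\<Pi>\<^sub>M u\<in>K k. \<Pi>\<^sub>M k\<in>UNIV. borel)"
      by (rule measurable_tree_W) (simp add: K_def)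
    show "(\<lambda>c. f k (tree_W (v @ [k]) (n k) c)) \<in> borel_measurable (\<Pi>\<^sub>M u\<in>K k. \<Pi>\<^sub>M k\<in>UNIV. borel)"
      by measurable
  qed
  moreover have "tree_W (v @ [k]) (n k) (restrict (\<lambda>i. \<xi> i \<omega>) (K k)) = W (v @ [k]) (n k) \<omega>" for k \<omega>
    unfolding W_def by (rule tree_W_restrict) (simp add: K_def)
  ultimately show ?thesis by simp
qed

text \<open>The offspring of \<open>v\<close> is independent of the offspring of its strict descendants, so an
  independent copy \<open>\<omega>'\<close> may be used for the latter.\<close>

lemma nn_integral_condition_offspring:
  fixes v
  defines "K \<equiv> {v @ u |u. u \<noteq> []}"
  assumes g: "(\<lambda>(a, c). g a c) \<in> borel_measurable ((\<Pi>\<^sub>M k\<in>UNIV. borel) \<Otimes>\<^sub>M (\<Pi>\<^sub>M u\<in>K. \<Pi>\<^sub>M k\<in>UNIV. borel))"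
  shows "(\<integral>\<^sup>+\<omega>. g (\<xi> v \<omega>) (restrict (\<lambda>u. \<xi> u \<omega>) K) \<partial>M) =
    (\<integral>\<^sup>+\<omega>. \<integral>\<^sup>+\<omega>'. g (\<xi> v \<omega>) (restrict (\<lambda>u. \<xi> u \<omega>') K) \<partial>M \<partial>M)"
proof -
  let ?N = "\<Pi>\<^sub>M k\<in>(UNIV :: nat set). (borel :: (real \<times> real) measure)"
  let ?A = "\<Pi>\<^sub>M u\<in>{v}. ?N" and ?B = "\<Pi>\<^sub>M u\<in>K. ?N"
  let ?X = "\<lambda>\<omega>. restrict (\<lambda>u. \<xi> u \<omega>) {v}" and ?Y = "\<lambda>\<omega>. restrict (\<lambda>u. \<xi> u \<omega>) K"
  have "indep_var ?A ?X ?B ?Y"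
    by (rule indep_var_restrict[OF indep]) (auto simp: K_def)
  then have X[measurable]: "?X \<in> M \<rightarrow>\<^sub>M ?A" and Y[measurable]: "?Y \<in> M \<rightarrow>\<^sub>M ?B"
    and XY: "distr M ?A ?X \<Otimes>\<^sub>M distr M ?B ?Y = distr M (?A \<Otimes>\<^sub>M ?B) (\<lambda>\<omega>. (?X \<omega>, ?Y \<omega>))"
    unfolding indep_var_distribution_eq by auto
  interpret Y: prob_space "distr M ?B ?Y" by (rule prob_space_distr) measurable
  let ?g = "\<lambda>(a, c). g (a v) c"
  have "(\<lambda>(a, c). (a v, c)) \<in> ?A \<Otimes>\<^sub>M ?B \<rightarrow>\<^sub>M ?N \<Otimes>\<^sub>M ?B" by measurable
  from measurable_compose[OF this g] have G[measurable]: "?g \<in> borel_measurable (?A \<Otimes>\<^sub>M ?B)"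
    by (simp add: case_prod_beta')
  have "(\<integral>\<^sup>+\<omega>. g (\<xi> v \<omega>) (?Y \<omega>) \<partial>M) = (\<integral>\<^sup>+\<omega>. ?g (?X \<omega>, ?Y \<omega>) \<partial>M)" by simp
  also have "\<dots> = (\<integral>\<^sup>+p. ?g p \<partial>distr M (?A \<Otimes>\<^sub>M ?B) (\<lambda>\<omega>. (?X \<omega>, ?Y \<omega>)))"
    by (subst nn_integral_distr) auto
  also have "\<dots> = (\<integral>\<^sup>+p. ?g p \<partial>(distr M ?A ?X \<Otimes>\<^sub>M distr M ?B ?Y))"
    unfolding XY ..
  also have "\<dots> = (\<integral>\<^sup>+a. \<integral>\<^sup>+c. ?g (a, c) \<partial>distr M ?B ?Y \<partial>distr M ?A ?X)"
    by (rule Y.nn_integral_fst[symmetric]) measurable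
  also have "\<dots> = (\<integral>\<^sup>+\<omega>. \<integral>\<^sup>+c. ?g (?X \<omega>, c) \<partial>distr M ?B ?Y \<partial>M)"
    by (subst nn_integral_distr) auto
  also have "\<dots> = (\<integral>\<^sup>+\<omega>. \<integral>\<^sup>+\<omega>'. ?g (?X \<omega>, ?Y \<omega>') \<partial>M \<partial>M)"
  proof (rule nn_integral_cong)
    fix \<omega> assume "\<omega> \<in> space M"
    then have "?X \<omega> \<in> space ?A" by (rule measurable_space[OF X])
    then have "(\<lambda>c. ?g (?X \<omega>, c)) \<in> borel_measurable ?B"
      by (rule measurable_compose[OF measurable_Pair1' G])
    then show "(\<integral>\<^sup>+c. ?g (?X \<omega>, c) \<partial>distr M ?B ?Y) = (\<integral>\<^sup>+\<omega>'. ?g (?X \<omega>, ?Y \<omega>') \<partial>M)"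
      by (simp add: nn_integral_distr[OF Y])
  qed
  finally show ?thesis by simp
qed


text \<open>With the offspring of \<open>v\<close> frozen, the inner expectation factorises over the
  children, and the induction hypothesis applies at \<open>s * weight\<close>. The outer expectation
  is the exponential formula with \<open>h = ennexpm1\<close> of the previous iterate.\<close>

lemma nn_integral_ennexp_W:
  assumes "0 \<le> s"
  shows "(\<integral>\<^sup>+\<omega>. ennexp (ennreal s * W v n \<omega>) \<partial>M) = ennexp (cumulant_iter n s)"
  using assms
proof (induction n arbitrary: v s)
  case 0
  then show ?case by (simp add: W_0 emeasure_space_1)
next
  case (Suc n)
  define K where "K = {v @ u |u. u \<noteq> []}"
  define g where "g a c = (SUP N. \<Prod>k<N. ennexp (ennreal (s * weight (a k)) * tree_W (v @ [k]) n c))"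
    for a :: "nat \<Rightarrow> real \<times> real" and c
  let ?h = "\<lambda>z. ennexpm1 (cumulant_iter n (s * weight z))"
  have K: "(v @ [k]) @ u \<in> K" for k u by (auto simp: K_def)
  have [measurable]: "tree_W (v @ [k]) n \<in> borel_measurable (\<Pi>\<^sub>M u\<in>K. \<Pi>\<^sub>M k\<in>UNIV. borel)" for k
    by (rule measurable_tree_W[OF K])
  have g: "g (\<xi> v \<omega>) (restrict (\<lambda>u. \<xi> u \<omega>') K) =
      (SUP N. \<Prod>k<N. ennexp (ennreal (s * weight (\<xi> v \<omega> k)) * W (v @ [k]) n \<omega>'))" for \<omega> \<omega>'
    unfolding g_def tree_W_restrict[OF K] W_def ..
  have "(\<integral>\<^sup>+\<omega>. ennexp (ennreal s * W v (Suc n) \<omega>) \<partial>M) = (\<integral>\<^sup>+\<omega>. g (\<xi> v \<omega>) (restrict (\<lambda>u. \<xi> u \<omega>) K) \<partial>M)"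
  proof (rule nn_integral_cong)
    fix \<omega>
    have "ennreal s * W v (Suc n) \<omega> = (\<Sum>k. ennreal (s * weight (\<xi> v \<omega> k)) * W (v @ [k]) n \<omega>)"
      using Suc.prems by (simp add: W_Suc ennreal_mult weight_pos mult.assoc flip: ennreal_suminf_cmult)
    then show "ennexp (ennreal s * W v (Suc n) \<omega>) = g (\<xi> v \<omega>) (restrict (\<lambda>u. \<xi> u \<omega>) K)"
      unfolding g by (simp only: ennexp_suminf)
  qed
  also have "\<dots> = (\<integral>\<^sup>+\<omega>. \<integral>\<^sup>+\<omega>'. g (\<xi> v \<omega>) (restrict (\<lambda>u. \<xi> u \<omega>') K) \<partial>M \<partial>M)"
    unfolding K_def
  proof (rule nn_integral_condition_offspring, unfold K_def[symmetric])
    show "(\<lambda>(a, c). g a c) \<in> borel_measurable ((\<Pi>\<^sub>M k\<in>UNIV. borel) \<Otimes>\<^sub>M (\<Pi>\<^sub>M u\<in>K. \<Pi>\<^sub>M k\<in>UNIV. borel))"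
      unfolding g_def by measurable
  qed
  also have "\<dots> = (\<integral>\<^sup>+\<omega>. (SUP N. \<Prod>k<N. 1 + ?h (\<xi> v \<omega> k)) \<partial>M)"
  proof (rule nn_integral_cong)
    fix \<omega>
    let ?X = "\<lambda>k \<omega>'. ennexp (ennreal (s * weight (\<xi> v \<omega> k)) * W (v @ [k]) n \<omega>')"
    \<comment> \<open>Independence is used for finitely many children only; the partial products
      increase because every factor is at least 1, so the supremum can be taken outside the
      integral.\<close>
    have "incseq (\<lambda>N \<omega>'. \<Prod>k<N. ?X k \<omega>')"
      unfolding one_plus_ennexpm1[symmetric] using incseq_prod_one_plus
      by (auto simp: incseq_def le_fun_def)
    then have "(\<integral>\<^sup>+\<omega>'. g (\<xi> v \<omega>) (restrict (\<lambda>u. \<xi> u \<omega>') K) \<partial>M) = (SUP N. \<integral>\<^sup>+\<omega>'. (\<Prod>k<N. ?X k \<omega>') \<partial>M)"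
      unfolding g by (rule nn_integral_monotone_convergence_SUP) measurable
    also have "\<dots> = (SUP N. \<Prod>k<N. \<integral>\<^sup>+\<omega>'. ?X k \<omega>' \<partial>M)"
      by (subst indep_vars_nn_integral[OF _ indep_subtrees]) auto
    also have "\<dots> = (SUP N. \<Prod>k<N. 1 + ?h (\<xi> v \<omega> k))"
      using Suc.prems by (simp add: Suc.IH weight_pos one_plus_ennexpm1)
    finally show "(\<integral>\<^sup>+\<omega>'. g (\<xi> v \<omega>) (restrict (\<lambda>u. \<xi> u \<omega>') K) \<partial>M) = (SUP N. \<Prod>k<N. 1 + ?h (\<xi> v \<omega> k))" .
  qed
  also have "\<dots> = ennexp (\<integral>\<^sup>+z. ?h z * indicator quadrant z \<partial>lborel)"
    by (rule nn_integral_pp_prod[OF prob_space_axioms poisson]) measurable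
  also have "(\<integral>\<^sup>+z. ?h z * indicator quadrant z \<partial>lborel) = cumulant_iter (Suc n) s"
    by (subst nn_integral_quadrant_weight[where f = "\<lambda>w. ennexpm1 (cumulant_iter n (s * w))"]) auto
  finally show ?case .
qed

text \<open>The integrals of \<open>weight ^ q\<close> are \<open>1 / q\<^sup>2\<close>: mean 1 from
  \<open>q = 1\<close>, variance \<open>1 / 4\<close> from \<open>q = 2\<close>, hence second moment
  \<open>5 / 4\<close>.\<close>

lemma nn_integral_weight_sum:
  shows "(\<integral>\<^sup>+\<omega>. (\<Sum>k. ennreal (weight (\<xi> v \<omega> k))) \<partial>M) = 1"
    and "(\<integral>\<^sup>+\<omega>. (\<Sum>k. ennreal (weight (\<xi> v \<omega> k)))\<^sup>2 \<partial>M) = ennreal (5 / 4)"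
    and "(\<integral>\<^sup>+\<omega>. (\<Sum>k. ennreal ((weight (\<xi> v \<omega> k))\<^sup>2)) \<partial>M) = ennreal (1 / 4)"
proof -
  have 1: "(\<integral>\<^sup>+p. ennreal (weight p) * indicator quadrant p \<partial>lborel) = ennreal 1"
    using nn_integral_quadrant_weight_power[of 1] by simp
  have 2: "(\<integral>\<^sup>+p. ennreal ((weight p)\<^sup>2) * indicator quadrant p \<partial>lborel) = ennreal (1 / 4)"
    using nn_integral_quadrant_weight_power[of 2] by simp
  show "(\<integral>\<^sup>+\<omega>. (\<Sum>k. ennreal (weight (\<xi> v \<omega> k))) \<partial>M) = 1"
    using nn_integral_pp_sum[OF prob_space_axioms poisson _ weight_pos(2) 1] by simp
  show "(\<integral>\<^sup>+\<omega>. (\<Sum>k. ennreal ((weight (\<xi> v \<omega> k))\<^sup>2)) \<partial>M) = ennreal (1 / 4)"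
    by (rule nn_integral_pp_sum[OF prob_space_axioms poisson _ _ 2]) auto
  show "(\<integral>\<^sup>+\<omega>. (\<Sum>k. ennreal (weight (\<xi> v \<omega> k)))\<^sup>2 \<partial>M) = ennreal (5 / 4)"
    using nn_integral_pp_sum_square[OF prob_space_axioms poisson _ weight_pos(2) 1 _ 2] by simp
qed

lemma nn_integral_W: "(\<integral>\<^sup>+\<omega>. W v n \<omega> \<partial>M) = 1"
proof (induction n arbitrary: v)
  case 0
  then show ?case by (simp add: W_0 emeasure_space_1)
next
  case (Suc n)
  define K where "K = {v @ u |u. u \<noteq> []}"
  define g where "g a c = (\<Sum>k. ennreal (weight (a k)) * tree_W (v @ [k]) n c)"
    for a :: "nat \<Rightarrow> real \<times> real" and c
  have K: "(v @ [k]) @ u \<in> K" for k u by (auto simp: K_def)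
  have [measurable]: "tree_W (v @ [k]) n \<in> borel_measurable (\<Pi>\<^sub>M u\<in>K. \<Pi>\<^sub>M k\<in>UNIV. borel)" for k
    by (rule measurable_tree_W[OF K])
  have g: "g (\<xi> v \<omega>) (restrict (\<lambda>u. \<xi> u \<omega>') K) =
      (\<Sum>k. ennreal (weight (\<xi> v \<omega> k)) * W (v @ [k]) n \<omega>')" for \<omega> \<omega>'
    unfolding g_def tree_W_restrict[OF K] W_def ..
  have "(\<integral>\<^sup>+\<omega>. W v (Suc n) \<omega> \<partial>M) = (\<integral>\<^sup>+\<omega>. g (\<xi> v \<omega>) (restrict (\<lambda>u. \<xi> u \<omega>) K) \<partial>M)"
    by (simp add: g W_Suc)
  also have "\<dots> = (\<integral>\<^sup>+\<omega>. \<integral>\<^sup>+\<omega>'. g (\<xi> v \<omega>) (restrict (\<lambda>u. \<xi> u \<omega>') K) \<partial>M \<partial>M)"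
    unfolding K_def
  proof (rule nn_integral_condition_offspring, unfold K_def[symmetric])
    show "(\<lambda>(a, c). g a c) \<in> borel_measurable ((\<Pi>\<^sub>M k\<in>UNIV. borel) \<Otimes>\<^sub>M (\<Pi>\<^sub>M u\<in>K. \<Pi>\<^sub>M k\<in>UNIV. borel))"
      unfolding g_def by measurable
  qed
  also have "\<dots> = (\<integral>\<^sup>+\<omega>. (\<Sum>k. ennreal (weight (\<xi> v \<omega> k))) \<partial>M)"
    by (simp add: g nn_integral_suminf nn_integral_cmult Suc.IH)
  also have "\<dots> = 1" by (rule nn_integral_weight_sum)
  finally show ?case .
qed

lemma AE_W_finite: "AE \<omega> in M. W v n \<omega> \<noteq> \<infinity>"
  by (rule nn_integral_noteq_infinite) (simp_all add: nn_integral_W)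

end

section \<open>Second moments and almost sure convergence\<close>

context branching
begin

text \<open>The variance of generation \<open>n\<close>, that is the geometric sum
  \<open>1/4 + ... + (1/4) ^ n\<close>.\<close>

definition excess :: "nat \<Rightarrow> real" where
  "excess n = (1 - (1 / 4) ^ n) / 3"

lemma excess_simps: "excess 0 = 0" "excess (Suc n) = 1 / 4 + excess n / 4"
  "excess (Suc n) - excess n = (1 / 4) ^ Suc n"
  by (simp_all add: excess_def field_simps)

lemma excess_nonneg: "0 \<le> excess n"
  by (simp add: excess_def power_le_one)

text \<open>Expand over pairs of children: distinct children are independent and contribute
  expectation 1, equal children contribute the extra \<open>excess\<close>. The dependence on
  \<open>min n m\<close> is the martingale orthogonality, obtained here without conditional
  expectations.\<close>

lemma nn_integral_W_mult: "(\<integral>\<^sup>+\<omega>. W v n \<omega> * W v m \<omega> \<partial>M) = ennreal (1 + excess (min n m))"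
proof (induction n arbitrary: v m)
  case 0
  then show ?case by (simp add: W_0 nn_integral_W excess_simps)
next
  case (Suc n)
  show ?case
  proof (cases m)
    case 0
    then show ?thesis by (simp add: W_0 nn_integral_W excess_simps)
  next
    case m: (Suc m)
    define d where "d = excess (min n m)"
    have d: "0 \<le> d" by (simp add: d_def excess_nonneg)
    define K where "K = {v @ u |u. u \<noteq> []}"
    define g where "g a c = (\<Sum>j. ennreal (weight (a j)) * tree_W (v @ [j]) n c) * (\<Sum>k. ennreal (weight (a k)) * tree_W (v @ [k]) m c)"
      for a :: "nat \<Rightarrow> real \<times> real" and c
    have K: "(v @ [k]) @ u \<in> K" for k u by (auto simp: K_def)
    have [measurable]: "tree_W (v @ [k]) n \<in> borel_measurable (\<Pi>\<^sub>M u\<in>K. \<Pi>\<^sub>M k\<in>UNIV. borel)" for k n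
      by (rule measurable_tree_W[OF K])
    have g: "g (\<xi> v \<omega>) (restrict (\<lambda>u. \<xi> u \<omega>') K) =
        (\<Sum>j. ennreal (weight (\<xi> v \<omega> j)) * W (v @ [j]) n \<omega>') * (\<Sum>k. ennreal (weight (\<xi> v \<omega> k)) * W (v @ [k]) m \<omega>')" for \<omega> \<omega>'
      unfolding g_def tree_W_restrict[OF K] W_def ..
    have pair: "(\<integral>\<^sup>+\<omega>. W (v @ [j]) n \<omega> * W (v @ [k]) m \<omega> \<partial>M) = 1 + (if k = j then ennreal d else 0)" for j k
    proof (cases "k = j")
      case True
      then show ?thesis using d by (simp add: Suc.IH d_def)
    next
      case False
      \<comment> \<open>One family indexed by the children, at generation \<open>n\<close> for
        \<open>j\<close> and \<open>m\<close> for the other, so that independence across subtrees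
        applies to the mixed product.\<close>
      define X where "X i = W (v @ [i]) (if i = j then n else m)" for i
      have "(\<integral>\<^sup>+\<omega>. W (v @ [j]) n \<omega> * W (v @ [k]) m \<omega> \<partial>M) = (\<integral>\<^sup>+\<omega>. (\<Prod>i\<in>{j, k}. X i \<omega>) \<partial>M)"
        using False by (simp add: X_def)
      also have "\<dots> = (\<Prod>i\<in>{j, k}. \<integral>\<^sup>+\<omega>. X i \<omega> \<partial>M)"
        unfolding X_def by (rule indep_vars_nn_integral[OF _ indep_subtrees[where f = "\<lambda>_ x. x"]]) auto
      also have "\<dots> = 1" by (simp add: X_def nn_integral_W)
      finally show ?thesis using False by simp
    qed
    have "(\<integral>\<^sup>+\<omega>. W v (Suc n) \<omega> * W v (Suc m) \<omega> \<partial>M) = (\<integral>\<^sup>+\<omega>. g (\<xi> v \<omega>) (restrict (\<lambda>u. \<xi> u \<omega>) K) \<partial>M)"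
      by (simp add: g W_Suc)
    also have "\<dots> = (\<integral>\<^sup>+\<omega>. \<integral>\<^sup>+\<omega>'. g (\<xi> v \<omega>) (restrict (\<lambda>u. \<xi> u \<omega>') K) \<partial>M \<partial>M)"
      unfolding K_def
    proof (rule nn_integral_condition_offspring, unfold K_def[symmetric])
      show "(\<lambda>(a, c). g a c) \<in> borel_measurable ((\<Pi>\<^sub>M k\<in>UNIV. borel) \<Otimes>\<^sub>M (\<Pi>\<^sub>M u\<in>K. \<Pi>\<^sub>M k\<in>UNIV. borel))"
        unfolding g_def by measurable
    qed
    also have "\<dots> = (\<integral>\<^sup>+\<omega>. (\<Sum>k. ennreal (weight (\<xi> v \<omega> k)))\<^sup>2 + ennreal d * (\<Sum>k. ennreal ((weight (\<xi> v \<omega> k))\<^sup>2)) \<partial>M)"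
    proof (rule nn_integral_cong)
      fix \<omega>
      define w where "w k = ennreal (weight (\<xi> v \<omega> k))" for k
      have "(\<integral>\<^sup>+\<omega>'. g (\<xi> v \<omega>) (restrict (\<lambda>u. \<xi> u \<omega>') K) \<partial>M) =
          (\<integral>\<^sup>+\<omega>'. (\<Sum>j. \<Sum>k. w j * w k * (W (v @ [j]) n \<omega>' * W (v @ [k]) m \<omega>')) \<partial>M)"
        unfolding g w_def[symmetric]
        by (simp add: ac_simps flip: ennreal_suminf_multc ennreal_suminf_cmult)
      also have "\<dots> = (\<Sum>j. \<Sum>k. w j * w k * (1 + (if k = j then ennreal d else 0)))"
        by (simp add: nn_integral_suminf nn_integral_cmult pair)
      also have "\<dots> = (\<Sum>j. \<Sum>k. w j * w k) + (\<Sum>j. \<Sum>k. if k = j then w j * w k * ennreal d else 0)"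
      proof -
        have "w j * w k * (1 + (if k = j then ennreal d else 0)) = w j * w k + (if k = j then w j * w k * ennreal d else 0)" for j k
          by (simp add: distrib_left)
        then show ?thesis by (simp add: suminf_add[symmetric])
      qed
      also have "\<dots> = (\<Sum>k. w k)\<^sup>2 + ennreal d * (\<Sum>j. (w j)\<^sup>2)"
      proof -
        have "(\<Sum>k. if k = j then w j * w k * ennreal d else 0) = ennreal d * (w j)\<^sup>2" for j
          using sums_unique[OF sums_single[of j "\<lambda>k. w j * w k * ennreal d"]]
          by (simp add: power2_eq_square ac_simps)
        then show ?thesis by (simp add: power2_eq_square)
      qed
      finally show "(\<integral>\<^sup>+\<omega>'. g (\<xi> v \<omega>) (restrict (\<lambda>u. \<xi> u \<omega>') K) \<partial>M) =
          (\<Sum>k. ennreal (weight (\<xi> v \<omega> k)))\<^sup>2 + ennreal d * (\<Sum>k. ennreal ((weight (\<xi> v \<omega> k))\<^sup>2))"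
        by (simp add: w_def ennreal_power weight_pos)
    qed
    also have "\<dots> = ennreal (5 / 4) + ennreal d * ennreal (1 / 4)"
      by (simp add: nn_integral_add nn_integral_cmult nn_integral_weight_sum)
    also have "\<dots> = ennreal (1 + excess (min (Suc n) (Suc m)))"
      using d by (simp add: excess_simps d_def[symmetric] flip: ennreal_plus ennreal_mult)
    finally show ?thesis by (simp add: m)
  qed
qed

text \<open>Expanding the square leaves \<open>excess (Suc n) - excess n\<close>, since the mixed
  moment equals the second moment of generation \<open>n\<close>. The mixed term is added to the
  left so that the expansion can be integrated in \<open>ennreal\<close>.\<close>

lemma nn_integral_W_increment:
  "(\<integral>\<^sup>+\<omega>. ennreal ((enn2real (W v (Suc n) \<omega>) - enn2real (W v n \<omega>))\<^sup>2) \<partial>M) = ennreal ((1 / 4) ^ Suc n)"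
    (is "?x = _")
proof -
  let ?D = "\<lambda>\<omega>. enn2real (W v (Suc n) \<omega>) - enn2real (W v n \<omega>)"
  have "AE \<omega> in M. ennreal ((?D \<omega>)\<^sup>2) + 2 * (W v (Suc n) \<omega> * W v n \<omega>) =
      W v (Suc n) \<omega> * W v (Suc n) \<omega> + W v n \<omega> * W v n \<omega>"
    using AE_W_finite[of v "Suc n"] AE_W_finite[of v n]
  proof eventually_elim
    case (elim \<omega>)
    obtain a b where ab: "W v (Suc n) \<omega> = ennreal a" "0 \<le> a" "W v n \<omega> = ennreal b" "0 \<le> b"
      using elim by (cases "W v (Suc n) \<omega>"; cases "W v n \<omega>") auto
    have "ennreal ((a - b)\<^sup>2) + 2 * (ennreal a * ennreal b) = ennreal ((a - b)\<^sup>2 + 2 * (a * b))"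
      using ab by (simp flip: ennreal_plus ennreal_mult ennreal_numeral)
    also have "(a - b)\<^sup>2 + 2 * (a * b) = a * a + b * b"
      by (simp add: power2_eq_square algebra_simps)
    also have "ennreal \<dots> = ennreal a * ennreal a + ennreal b * ennreal b"
      using ab by (simp add: ennreal_mult)
    finally show ?case using ab by simp
  qed
  then have "(\<integral>\<^sup>+\<omega>. ennreal ((?D \<omega>)\<^sup>2) + 2 * (W v (Suc n) \<omega> * W v n \<omega>) \<partial>M) =
      (\<integral>\<^sup>+\<omega>. W v (Suc n) \<omega> * W v (Suc n) \<omega> + W v n \<omega> * W v n \<omega> \<partial>M)"
    by (rule nn_integral_cong_AE)
  then have "?x + 2 * ennreal (1 + excess n) = ennreal (1 + excess (Suc n)) + ennreal (1 + excess n)"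
    by (simp add: nn_integral_add nn_integral_cmult nn_integral_W_mult del: ennreal_plus)
  moreover have "ennreal (2 * (1 + excess n)) = 2 * ennreal (1 + excess n)"
    using ennreal_mult[of 2 "1 + excess n"] excess_nonneg[of n] by (simp del: ennreal_plus)
  moreover have "ennreal ((1 + excess (Suc n)) + (1 + excess n)) = ennreal (1 + excess (Suc n)) + ennreal (1 + excess n)"
    using excess_nonneg[of n] excess_nonneg[of "Suc n"] by (intro ennreal_plus) auto
  ultimately have eq: "?x + ennreal (2 * (1 + excess n)) = ennreal ((1 + excess (Suc n)) + (1 + excess n))"
    by (simp only:)
  have "?x \<le> ennreal ((1 + excess (Suc n)) + (1 + excess n))"
    unfolding eq[symmetric] by simp
  then obtain y where y: "?x = ennreal y" "0 \<le> y"
    by (cases ?x) (auto simp: top_unique)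
  have "ennreal (y + 2 * (1 + excess n)) = ennreal ((1 + excess (Suc n)) + (1 + excess n))"
    using eq y excess_nonneg[of n] by (simp add: y)
  then have "y + 2 * (1 + excess n) = (1 + excess (Suc n)) + (1 + excess n)"
    using y excess_nonneg[of n] excess_nonneg[of "Suc n"] by (subst (asm) ennreal_inj) auto
  then have "y = excess (Suc n) - excess n" by simp
  then show ?thesis using y by (simp only: excess_simps(3))
qed

text \<open>From \<open>\<bar>x\<bar> \<le> 2 ^ n * x\<^sup>2 + (1/2) ^ n\<close> and second moments
  \<open>(1/4) ^ Suc n\<close>, the expected absolute increments are summable, so almost surely the
  increments form an absolutely convergent series.\<close>

lemma AE_W_convergent:
  "AE \<omega> in M. (\<forall>n. W v n \<omega> \<noteq> \<infinity>) \<and> (\<exists>x\<ge>0. (\<lambda>n. W v n \<omega>) \<longlonglongrightarrow> ennreal x)"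
proof -
  let ?D = "\<lambda>n \<omega>. enn2real (W v (Suc n) \<omega>) - enn2real (W v n \<omega>)"
  have le: "ennreal \<bar>x\<bar> \<le> ennreal (2 ^ n) * ennreal (x\<^sup>2) + ennreal ((1 / 2) ^ n)" for x :: real and n :: nat
  proof -
    have "0 \<le> 2 ^ n * (\<bar>x\<bar> - (1 / 2) ^ n)\<^sup>2" by simp
    also have "\<dots> = 2 ^ n * x\<^sup>2 - 2 * \<bar>x\<bar> + (1 / 2) ^ n"
      by (simp add: power2_eq_square algebra_simps power_one_over)
    finally have "\<bar>x\<bar> \<le> 2 ^ n * x\<^sup>2 + (1 / 2) ^ n"
      using abs_ge_zero[of x] by linarith
    then have "ennreal \<bar>x\<bar> \<le> ennreal (2 ^ n * x\<^sup>2 + (1 / 2) ^ n)" by (rule ennreal_leI)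
    also have "\<dots> = ennreal (2 ^ n) * ennreal (x\<^sup>2) + ennreal ((1 / 2) ^ n)"
      by (simp add: ennreal_mult)
    finally show ?thesis .
  qed
  have "(\<integral>\<^sup>+\<omega>. (\<Sum>n. ennreal \<bar>?D n \<omega>\<bar>) \<partial>M) = (\<Sum>n. \<integral>\<^sup>+\<omega>. ennreal \<bar>?D n \<omega>\<bar> \<partial>M)"
    by (rule nn_integral_suminf) measurable
  also have "\<dots> \<le> (\<Sum>n. ennreal (2 * (1 / 2) ^ n))"
  proof (rule suminf_le)
    fix n
    have "(\<integral>\<^sup>+\<omega>. ennreal \<bar>?D n \<omega>\<bar> \<partial>M) \<le> (\<integral>\<^sup>+\<omega>. ennreal (2 ^ n) * ennreal ((?D n \<omega>)\<^sup>2) + ennreal ((1 / 2) ^ n) \<partial>M)"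
      by (intro nn_integral_mono le)
    also have "\<dots> = ennreal (2 ^ n) * ennreal ((1 / 4) ^ Suc n) + ennreal ((1 / 2) ^ n)"
      by (simp add: nn_integral_add nn_integral_cmult nn_integral_W_increment emeasure_space_1 del: power_Suc)
    also have "\<dots> = ennreal (2 ^ n * (1 / 4) ^ Suc n + (1 / 2) ^ n)"
      by (simp add: ennreal_mult del: power_Suc)
    also have "\<dots> \<le> ennreal (2 * (1 / 2) ^ n)"
    proof (rule ennreal_leI)
      have "(2::real) ^ n * (1 / 4) ^ Suc n = (1 / 2) ^ n / 4"
        by (simp flip: power_mult_distrib)
      then show "(2::real) ^ n * (1 / 4) ^ Suc n + (1 / 2) ^ n \<le> 2 * (1 / 2) ^ n" by simp
    qed
    finally show "(\<integral>\<^sup>+\<omega>. ennreal \<bar>?D n \<omega>\<bar> \<partial>M) \<le> ennreal (2 * (1 / 2) ^ n)" .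
  qed auto
  also have "\<dots> = ennreal (2 * (1 / (1 - 1 / 2)))"
    by (intro suminf_ennreal_eq sums_mult geometric_sums) auto
  finally have "(\<integral>\<^sup>+\<omega>. (\<Sum>n. ennreal \<bar>?D n \<omega>\<bar>) \<partial>M) \<noteq> \<infinity>"
    by (auto simp: top_unique)
  then have "AE \<omega> in M. (\<Sum>n. ennreal \<bar>?D n \<omega>\<bar>) \<noteq> \<infinity>"
    by (intro nn_integral_noteq_infinite) auto
  moreover have "AE \<omega> in M. \<forall>n. W v n \<omega> \<noteq> \<infinity>"
    unfolding AE_all_countable using AE_W_finite by blast
  ultimately show ?thesis
  proof eventually_elim
    case (elim \<omega>)
    define X where "X n = enn2real (W v n \<omega>)" for n
    have WX: "W v n \<omega> = ennreal (X n)" for n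
      using elim(2) by (simp add: X_def less_top)
    have "summable (\<lambda>n. \<bar>X (Suc n) - X n\<bar>)"
      using elim(1) by (intro summable_suminf_not_top) (auto simp: X_def)
    then have "summable (\<lambda>n. X (Suc n) - X n)" by (rule summable_rabs_cancel)
    then have "(\<lambda>N. \<Sum>n<N. X (Suc n) - X n) \<longlonglongrightarrow> (\<Sum>n. X (Suc n) - X n)" by (rule summable_LIMSEQ)
    then have "(\<lambda>N. X N - X 0) \<longlonglongrightarrow> (\<Sum>n. X (Suc n) - X n)" by (simp add: sum_lessThan_telescope)
    then have "(\<lambda>N. (X N - X 0) + X 0) \<longlonglongrightarrow> (\<Sum>n. X (Suc n) - X n) + X 0"
      by (intro tendsto_add tendsto_const)
    then have lim: "X \<longlonglongrightarrow> (\<Sum>n. X (Suc n) - X n) + X 0" by simp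
    moreover have "0 \<le> (\<Sum>n. X (Suc n) - X n) + X 0"
      by (rule LIMSEQ_le_const[OF lim]) (auto simp: X_def)
    ultimately show ?case
      using elim(2) unfolding WX by (blast intro: tendsto_ennrealI)
  qed
qed

lemma AE_brw_W: "AE \<omega> in M. brw_W \<xi> \<omega> \<noteq> \<infinity> \<and> (\<lambda>n. W [] n \<omega>) \<longlonglongrightarrow> brw_W \<xi> \<omega>"
  using AE_W_convergent[of "[]"]
proof eventually_elim
  case (elim \<omega>)
  then obtain x where "(\<lambda>n. W [] n \<omega>) \<longlonglongrightarrow> ennreal x" by blast
  moreover from this have "brw_W \<xi> \<omega> = ennreal x"
    unfolding brw_W_def brw_W_n_eq by (intro lim_imp_Liminf) auto
  ultimately show ?case by simp
qed

lemma measurable_brw_W [measurable]: "brw_W \<xi> \<in> borel_measurable M"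
  unfolding brw_W_def[abs_def] brw_W_n_eq by measurable

text \<open>At an infinite limit the two integrands differ, since \<open>enn2real\<close> returns 0
  there; almost sure finiteness makes this a null set.\<close>

lemma brw_phi_eq_nn_integral:
  assumes "0 \<le> r"
  shows "brw_phi M \<xi> r = (\<integral>\<^sup>+\<omega>. ennexp (ennreal r * brw_W \<xi> \<omega>) \<partial>M)"
  unfolding brw_phi_def
proof (rule nn_integral_cong_AE)
  show "AE \<omega> in M. ennreal (exp (r * enn2real (brw_W \<xi> \<omega>))) = ennexp (ennreal r * brw_W \<xi> \<omega>)"
    using AE_brw_W
  proof eventually_elim
    case (elim \<omega>)
    then obtain x where "brw_W \<xi> \<omega> = ennreal x" "0 \<le> x" by (cases "brw_W \<xi> \<omega>") auto
    then show ?case using assms by (simp add: ennexp_ennreal flip: ennreal_mult)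
  qed
qed

lemma ennexp_W_tendsto:
  assumes "0 \<le> r"
  shows "AE \<omega> in M. (\<lambda>n. ennexp (ennreal r * W [] n \<omega>)) \<longlonglongrightarrow> ennexp (ennreal r * brw_W \<xi> \<omega>)"
  using AE_brw_W AE_W_convergent[of "[]"]
proof eventually_elim
  case (elim \<omega>)
  define X x where "X n = enn2real (W [] n \<omega>)" and "x = enn2real (brw_W \<xi> \<omega>)" for n
  have X: "W [] n \<omega> = ennreal (X n)" "0 \<le> X n" for n using elim by (auto simp: X_def less_top)
  have x: "brw_W \<xi> \<omega> = ennreal x" "0 \<le> x" using elim by (auto simp: x_def less_top)
  have "X \<longlonglongrightarrow> x"
    unfolding X_def by (rule tendsto_enn2real) (use elim x in auto)
  then have "(\<lambda>n. ennreal (exp (r * X n))) \<longlonglongrightarrow> ennreal (exp (r * x))"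
    by (intro tendsto_intros)
  then show ?case using assms X x by (simp add: ennexp_ennreal flip: ennreal_mult)
qed

section \<open>Identification of the exponential moments and of the explosion point\<close>

lemma expectation_tendsto:
  assumes "0 < r" "r < r_star"
  shows "(\<lambda>n. \<integral>\<^sup>+\<omega>. ennexp (ennreal r * W [] n \<omega>) \<partial>M) \<longlonglongrightarrow> ennreal (exp (log_cumulant r))"
proof -
  have fin: "cumulant_iter n r \<noteq> \<top>" for n
    using cumulant_iter_le[OF assms, of n] by (auto simp: top_unique)
  have "(\<lambda>n. enn2real (cumulant_iter n r)) \<longlonglongrightarrow> log_cumulant r"
    by (rule tendsto_enn2real[OF cumulant_iter_tendsto[OF assms] less_imp_le[OF log_cumulant_spec(1)[OF assms]]])
  then have "(\<lambda>n. ennreal (exp (enn2real (cumulant_iter n r)))) \<longlonglongrightarrow> ennreal (exp (log_cumulant r))"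
    by (intro tendsto_ennrealI tendsto_exp)
  moreover have "ennexp (cumulant_iter n r) = ennreal (exp (enn2real (cumulant_iter n r)))" for n
    using fin by (simp add: ennexp_def)
  ultimately show ?thesis
    using assms by (simp only: nn_integral_ennexp_W less_imp_le)
qed

text \<open>Fatou's lemma applied to the convergent exponential moments.\<close>

lemma brw_phi_le:
  assumes "0 < r" "r < r_star"
  shows "brw_phi M \<xi> r \<le> ennreal (exp (log_cumulant r))"
proof -
  have "brw_phi M \<xi> r = (\<integral>\<^sup>+\<omega>. liminf (\<lambda>n. ennexp (ennreal r * W [] n \<omega>)) \<partial>M)"
    using assms unfolding brw_phi_eq_nn_integral[OF less_imp_le[OF assms(1)]]
    by (intro nn_integral_cong_AE eventually_mono[OF ennexp_W_tendsto[of r]] lim_imp_Liminf[symmetric]) auto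
  also have "\<dots> \<le> liminf (\<lambda>n. \<integral>\<^sup>+\<omega>. ennexp (ennreal r * W [] n \<omega>) \<partial>M)"
    by (rule nn_integral_liminf) measurable
  also have "\<dots> = ennreal (exp (log_cumulant r))"
    by (rule lim_imp_Liminf[OF _ expectation_tendsto[OF assms]]) simp
  finally show ?thesis .
qed

text \<open>Uniform integrability of \<open>exp (r W\<^sub>n)\<close> comes from a larger exponent \<open>r'\<close>.\<close>

lemma ennexp_truncate:
  assumes r: "0 \<le> r" "r \<le> r'" and L: "0 \<le> L" and w: "w \<noteq> \<top>"
  shows "ennexp (ennreal r * w) \<le>
    min (ennexp (ennreal r * w)) (ennreal (exp (r * L))) + ennreal (exp (- (r' - r) * L)) * ennexp (ennreal r' * w)"
proof -
  obtain x where x: "w = ennreal x" "0 \<le> x" using w by (cases w) auto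
  show ?thesis
  proof (cases "x \<le> L")
    case True
    then have "ennexp (ennreal r * w) \<le> ennreal (exp (r * L))"
      using r x by (auto simp: ennexp_ennreal mult_left_mono simp flip: ennreal_mult)
    then show ?thesis by (simp add: min_def add_increasing2)
  next
    case False
    have "0 \<le> (r' - r) * (x - L)" using False r by (intro mult_nonneg_nonneg) auto
    then have "exp (r * x) \<le> exp (- (r' - r) * L) * exp (r' * x)"
      by (simp add: algebra_simps flip: exp_add)
    then have "ennexp (ennreal r * w) \<le> ennreal (exp (- (r' - r) * L)) * ennexp (ennreal r' * w)"
      using r x by (simp add: ennexp_ennreal flip: ennreal_mult)
    then show ?thesis by (simp add: add_increasing)
  qed
qed

lemma brw_phi_ge:
  assumes "0 < r" "r < r_star"
  shows "ennreal (exp (log_cumulant r)) \<le> brw_phi M \<xi> r"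
proof -
  \<comment> \<open>The margin between \<open>r\<close> and \<open>r'\<close> bounds the part of
    \<open>exp (r W\<^sub>n)\<close> above level \<open>L\<close> by \<open>e L * C\<close>
    uniformly in \<open>n\<close>. The truncated part converges by dominated convergence;
    \<open>L\<close> tends to infinity last.\<close>
  obtain r' where r': "r < r'" "r' < r_star" using dense[OF assms(2)] by blast
  define e where "e L = exp (- (r' - r) * real L)" for L :: nat
  define C where "C = exp (log_cumulant r')"
  have le: "ennreal (exp (log_cumulant r)) \<le> brw_phi M \<xi> r + ennreal (e L) * ennreal C" for L
  proof -
    let ?Y = "\<lambda>\<omega>. min (ennexp (ennreal r * brw_W \<xi> \<omega>)) (ennreal (exp (r * real L)))"
    let ?X = "\<lambda>n \<omega>. min (ennexp (ennreal r * W [] n \<omega>)) (ennreal (exp (r * real L)))"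
    have X: "(\<lambda>n. \<integral>\<^sup>+\<omega>. ?X n \<omega> \<partial>M) \<longlonglongrightarrow> (\<integral>\<^sup>+\<omega>. ?Y \<omega> \<partial>M)"
    proof (rule nn_integral_dominated_convergence)
      show "(\<integral>\<^sup>+\<omega>. ennreal (exp (r * real L)) \<partial>M) < \<infinity>"
        by (simp add: emeasure_space_1)
      show "AE \<omega> in M. (\<lambda>n. ?X n \<omega>) \<longlonglongrightarrow> ?Y \<omega>"
        using ennexp_W_tendsto[of r] assms by (auto elim!: eventually_mono intro!: tendsto_min)
    qed auto
    have "(\<integral>\<^sup>+\<omega>. ennexp (ennreal r * W [] n \<omega>) \<partial>M) \<le> (\<integral>\<^sup>+\<omega>. ?X n \<omega> \<partial>M) + ennreal (e L) * ennreal C" for n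
    proof -
      have "(\<integral>\<^sup>+\<omega>. ennexp (ennreal r * W [] n \<omega>) \<partial>M) \<le>
          (\<integral>\<^sup>+\<omega>. ?X n \<omega> + ennreal (e L) * ennexp (ennreal r' * W [] n \<omega>) \<partial>M)"
      proof (rule nn_integral_mono_AE, use AE_W_finite[of "[]" n] in eventually_elim)
        case (elim \<omega>)
        show ?case
          unfolding e_def by (rule ennexp_truncate) (use assms r' elim in auto)
      qed
      also have "\<dots> = (\<integral>\<^sup>+\<omega>. ?X n \<omega> \<partial>M) + ennreal (e L) * ennexp (cumulant_iter n r')"
        using assms r' by (simp add: nn_integral_add nn_integral_cmult nn_integral_ennexp_W)
      also have "ennexp (cumulant_iter n r') \<le> ennexp (ennreal (log_cumulant r'))"
        using assms r' by (intro ennexp_mono cumulant_iter_le) auto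
      also have "\<dots> = ennreal C"
        unfolding C_def using assms r' log_cumulant_spec(1)[of r'] by (intro ennexp_ennreal) auto
      finally show ?thesis by (simp add: add_left_mono mult_left_mono)
    qed
    then have "ennreal (exp (log_cumulant r)) \<le> (\<integral>\<^sup>+\<omega>. ?Y \<omega> \<partial>M) + ennreal (e L) * ennreal C"
      by (intro LIMSEQ_le[OF expectation_tendsto[OF assms] tendsto_add[OF X tendsto_const]]) blast
    also have "(\<integral>\<^sup>+\<omega>. ?Y \<omega> \<partial>M) \<le> brw_phi M \<xi> r"
      unfolding brw_phi_eq_nn_integral[OF less_imp_le[OF assms(1)]] by (intro nn_integral_mono) simp
    finally show ?thesis by (simp add: add_right_mono)
  qed
  have "(\<lambda>L. e L * C) \<longlonglongrightarrow> 0"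
    unfolding e_def using r'(1) by real_asymp
  then have "(\<lambda>L. brw_phi M \<xi> r + ennreal (e L * C)) \<longlonglongrightarrow> brw_phi M \<xi> r + ennreal 0"
    by (intro tendsto_add tendsto_const tendsto_ennrealI)
  then have "(\<lambda>L. brw_phi M \<xi> r + ennreal (e L) * ennreal C) \<longlonglongrightarrow> brw_phi M \<xi> r"
    by (simp add: e_def C_def ennreal_mult)
  then show ?thesis
    by (rule LIMSEQ_le_const) (use le in blast)
qed

lemma brw_phi_eq:
  assumes "0 < r" "r < r_star"
  shows "brw_phi M \<xi> r = ennreal (exp (log_cumulant r))"
  using brw_phi_le[OF assms] brw_phi_ge[OF assms] by (rule antisym)

lemma brw_phi_mono: "r \<le> r' \<Longrightarrow> brw_phi M \<xi> r \<le> brw_phi M \<xi> r'"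
  unfolding brw_phi_def by (intro nn_integral_mono ennreal_leI) (simp add: mult_right_mono)

lemma explosion_point: "Sup {ereal r | r. brw_phi M \<xi> r < \<infinity>} = ereal r_star"
proof (rule antisym)
  show "Sup {ereal r | r. brw_phi M \<xi> r < \<infinity>} \<le> ereal r_star"
  proof (rule Sup_least, safe)
    fix r assume fin: "brw_phi M \<xi> r < \<infinity>"
    show "ereal r \<le> ereal r_star"
    proof (rule ccontr)
      assume "\<not> ereal r \<le> ereal r_star"
      then have r: "r_star < r" by simp
      obtain B where B: "brw_phi M \<xi> r = ennreal B" "0 \<le> B"
        using fin by (cases "brw_phi M \<xi> r") auto
      \<comment> \<open>If \<open>\<phi> r = B\<close> were finite beyond \<open>r_star\<close>,
        monotonicity would bound \<open>\<phi>\<close> by \<open>B\<close> on all of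
        \<open>(0, r_star)\<close>; at the point of height \<open>B + 1\<close> it equals
        \<open>exp (B + 1)\<close>, which exceeds \<open>B\<close>.\<close>
      define r' where "r' = exp (log_scale (B + 1))"
      have r': "0 < r'" "r' < r_star" "log_cumulant r' = B + 1"
        unfolding r'_def using log_cumulant_at_exp_log_scale[of "B + 1"] B by simp_all
      have "ennreal (exp (B + 1)) \<le> ennreal B"
        using brw_phi_eq[OF r'(1,2)] brw_phi_mono[of r' r] r r' B by simp
      then have "exp (B + 1) \<le> B" using B by (simp add: ennreal_le_iff)
      then show False using exp_ge_add_one_self[of "B + 1"] by linarith
    qed
  qed
  show "ereal r_star \<le> Sup {ereal r | r. brw_phi M \<xi> r < \<infinity>}"
  proof (rule dense_le)
    fix y assume "y < ereal r_star"
    \<comment> \<open>The formula for \<open>\<phi>\<close> is available at positive arguments only,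
      hence the maximum with 0.\<close>
    then have "max y 0 < ereal r_star" using r_star_pos by simp
    then obtain r where r: "max y 0 < ereal r" "ereal r < ereal r_star"
      using ereal_dense2 by blast
    then have "brw_phi M \<xi> r < \<infinity>" using brw_phi_eq[of r] by simp
    then have "ereal r \<le> Sup {ereal r | r. brw_phi M \<xi> r < \<infinity>}"
      by (intro Sup_upper) blast
    then show "y \<le> Sup {ereal r | r. brw_phi M \<xi> r < \<infinity>}"
      using r(1) by (meson less_imp_le max.strict_boundedE order_trans)
  qed
qed

end

theorem theorem1p1:
  fixes M :: "'a measure" and \<xi> :: "nat list \<Rightarrow> 'a \<Rightarrow> nat \<Rightarrow> real \<times> real"
  assumes "prob_space M"
    and "\<And>u. poisson_pp_lebesgue M (\<xi> u)"
    and "prob_space.indep_vars M (\<lambda>_. \<Pi>\<^sub>M k\<in>UNIV. (borel :: (real \<times> real) measure)) \<xi> UNIV"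
  shows "Sup {ereal r | r. brw_phi M \<xi> r < \<infinity>} = ereal r_star
    \<and> (\<forall>r. 0 < r \<and> r < r_star \<longrightarrow> brw_phi M \<xi> r = ennreal (F_inv (ln r_star - ln r)))"
proof -
  interpret branching M \<xi>
    using assms by (intro branching.intro branching_axioms.intro)
  show ?thesis
    using explosion_point by (auto simp: brw_phi_eq F_inv_eq)
qed

end
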